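(* Let $t\le r$ and $\sigma^2>0$, and let $\mathbf H$ be an $r\times t$ random matrix with i.i.d. circularly symmetric $CN(0,1)$ entries. Then the quantities $\delta^*=E\{\ln\det(\frac{\mathbf H^\dagger\mathbf H}{\pi e\sigma^2})\}$ and $V=t+\mathrm{Var}(\ln\det(\mathbf H^\dagger\mathbf H))$ (the Poltyrev capacity and channel dispersion of the $t\times r$ MIMO fast fading channel with noise $CN(0,\sigma^2I_r)$ under full dimensional transmission) equal $$\delta^*=-\gamma t+1-t+t\sum_{p=1}^{r-t}\frac1p+r\sum_{p=r-t+1}^{r-1}\frac1p-t\ln(\pi e\sigma^2),$$ $$V=t+\frac{\pi^2t}{6}-t\sum_{p=1}^{r-t}\frac1{p^2}-\sum_{p=r-t+1}^{r-1}\frac{r-p}{p^2},$$ where $\gamma=0.577\ldots$ is Euler's constant.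
   Context: Empty sums are zero. *)

theory Defs
  imports "HOL-Probability.Probability" "Jordan_Normal_Form.Schur_Decomposition"
begin

definition CN01 :: "complex measure" where
  "CN01 = density lborel (\<lambda>z. ennreal (exp (- (cmod z)\<^sup>2) / pi))"

definition iid_CN_matrices :: "nat \<Rightarrow> nat \<Rightarrow> (nat \<times> nat \<Rightarrow> complex) measure" where
  "iid_CN_matrices r t = PiM ({..<r} \<times> {..<t}) (\<lambda>_. CN01)"

definition to_mat :: "nat \<Rightarrow> nat \<Rightarrow> (nat \<times> nat \<Rightarrow> complex) \<Rightarrow> complex mat" where
  "to_mat r t H = mat r t (\<lambda>(i,j). H (i,j))"

end

theory Submission
  imports Defs
begin

text \<open>
  Condition on the last column \<open>v\<close> of an \<open>(r + 1) \<times> (t + 1)\<close> Gaussian matrix. A unitary map taking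
  \<open>v\<close> to a multiple of the last basis vector preserves both the Gram matrix and the law of the remaining
  columns, and the Gram determinant of the transformed matrix is \<open>\<parallel>v\<parallel>\<^sup>2\<close> times that of its upper left
  \<open>r \<times> t\<close> block. Hence \<open>det (H\<^sup>* H)\<close> is distributed as a product of independent Gamma variables with
  parameters \<open>r, r - 1, \<dots>, r - t + 1\<close>. The moments of the logarithm of a Gamma variable with
  parameter \<open>n\<close> come from differentiating \<open>E (X powr s) = Gamma (n + s) / Gamma n\<close> twice at \<open>s = 0\<close>,
  so means and variances add up to sums of \<open>\<psi> n\<close> and \<open>\<psi>' n\<close>.

  The unitary map is a product of three shears. Shears preserve Lebesgue measure by Fubini and translation
  invariance, so unitary invariance of the Gaussian measure needs no change of variables formula.
\<close>

subsection \<open>Shears, and the standard complex Gaussian\<close>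

lemma distr_PiM_lborel_translate:
  fixes c :: "'i \<Rightarrow> 'a::euclidean_space"
  assumes [simp]: "finite I"
  shows "distr (PiM I (\<lambda>_. lborel)) (PiM I (\<lambda>_. lborel)) (\<lambda>x. \<lambda>i\<in>I. x i + c i) = PiM I (\<lambda>_. lborel)"
proof -
  interpret product_sigma_finite "\<lambda>_::'i. lborel :: 'a measure" by standard
  show ?thesis
  proof (rule PiM_eqI)
    fix A :: "'i \<Rightarrow> 'a set" assume A: "\<And>i. i \<in> I \<Longrightarrow> A i \<in> sets lborel"
    have "(\<lambda>x. \<lambda>i\<in>I. x i + c i) -` Pi\<^sub>E I A \<inter> space (PiM I (\<lambda>_. lborel)) =
        Pi\<^sub>E I (\<lambda>i. (+) (c i) -` A i)"
      by (auto simp: space_PiM PiE_iff add.commute)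
    moreover have "(+) (c i) -` A i \<in> sets lborel" if "i \<in> I" for i
      using measurable_sets[of "(+) (c i)" borel borel "A i"] A[OF that] by simp
    moreover have "emeasure lborel ((+) (c i) -` A i) = emeasure lborel (A i)" if "i \<in> I" for i
      using A[OF that] emeasure_distr[of "(+) (c i)" lborel borel "A i"] by (simp add: lborel_distr_plus)
    ultimately show "emeasure (distr (PiM I (\<lambda>_. lborel)) (PiM I (\<lambda>_. lborel)) (\<lambda>x. \<lambda>i\<in>I. x i + c i)) (Pi\<^sub>E I A) =
        (\<Prod>i\<in>I. emeasure lborel (A i))"
      using A by (subst emeasure_distr) (auto intro!: sets_PiM_I_finite simp: emeasure_PiM)
  qed simp_all
qed

text \<open>Fubini freezes the \<open>B\<close>-block first. By \<open>dep\<close> the increment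
  \<open>g\<close> is then a constant vector, so the map is a mere translation of the
  \<open>A\<close>-block.\<close>

lemma nn_integral_PiM_lborel_shear:
  fixes g :: "('i \<Rightarrow> 'a::euclidean_space) \<Rightarrow> 'i \<Rightarrow> 'a"
  assumes fin: "finite A" "finite B" "A \<inter> B = {}"
    and f: "f \<in> borel_measurable (PiM (A \<union> B) (\<lambda>_. lborel))"
    and T: "(\<lambda>x. \<lambda>i\<in>A \<union> B. if i \<in> A then x i + g x i else x i)
      \<in> PiM (A \<union> B) (\<lambda>_. lborel) \<rightarrow>\<^sub>M PiM (A \<union> B) (\<lambda>_. lborel)"
    and dep: "\<And>x y i. i \<in> A \<Longrightarrow> (\<And>j. j \<in> B \<Longrightarrow> x j = y j) \<Longrightarrow> g x i = g y i"
  shows "(\<integral>\<^sup>+x. f (\<lambda>i\<in>A \<union> B. if i \<in> A then x i + g x i else x i) \<partial>PiM (A \<union> B) (\<lambda>_. lborel)) =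
    (\<integral>\<^sup>+x. f x \<partial>PiM (A \<union> B) (\<lambda>_. lborel))"
proof -
  interpret product_sigma_finite "\<lambda>_::'i. lborel :: 'a measure" by standard
  have BA: "B \<inter> A = {}" "B \<union> A = A \<union> B" using fin by auto
  define T where "T = (\<lambda>x. \<lambda>i\<in>A \<union> B. if i \<in> A then x i + g x i else x i)"
  have Tm: "T \<in> PiM (A \<union> B) (\<lambda>_. lborel) \<rightarrow>\<^sub>M PiM (A \<union> B) (\<lambda>_. lborel)" using T by (simp add: T_def)
  note fold = product_nn_integral_fold[OF BA(1) fin(2,1), unfolded BA(2)]
  have mm: "(\<lambda>x. f (merge B A (y, x))) \<in> borel_measurable (PiM A (\<lambda>_. lborel))"
    if y: "y \<in> space (PiM B (\<lambda>_. lborel))" for y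
  proof -
    have "(\<lambda>x. merge B A (y, x)) \<in> PiM A (\<lambda>_. lborel) \<rightarrow>\<^sub>M PiM (A \<union> B) (\<lambda>_. lborel)"
      using measurable_compose[OF measurable_Pair1'[OF y] measurable_merge[of B A]] unfolding BA(2) .
    from measurable_compose[OF this f] show ?thesis .
  qed
  have "(\<integral>\<^sup>+x. f (T x) \<partial>PiM (A \<union> B) (\<lambda>_. lborel)) =
     (\<integral>\<^sup>+y. \<integral>\<^sup>+x. f (T (merge B A (y, x))) \<partial>PiM A (\<lambda>_. lborel) \<partial>PiM B (\<lambda>_. lborel))"
    by (rule fold) (rule measurable_compose[OF Tm f])
  also have "\<dots> = (\<integral>\<^sup>+y. \<integral>\<^sup>+x. f (merge B A (y, x)) \<partial>PiM A (\<lambda>_. lborel) \<partial>PiM B (\<lambda>_. lborel))"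
  proof (rule nn_integral_cong)
    fix y :: "'i \<Rightarrow> 'a" assume y: "y \<in> space (PiM B (\<lambda>_. lborel))"
    have eq: "T (merge B A (y, x)) = merge B A (y, \<lambda>i\<in>A. x i + g y i)" for x
    proof
      fix i
      have "g (merge B A (y, x)) i = g y i" if "i \<in> A"
        using that by (intro dep) (auto simp: merge_def)
      then show "T (merge B A (y, x)) i = merge B A (y, \<lambda>i\<in>A. x i + g y i) i"
        using BA(1) by (auto simp: T_def merge_def)
    qed
    have [measurable]: "(\<lambda>x. \<lambda>i\<in>A. x i + g y i) \<in> PiM A (\<lambda>_. lborel) \<rightarrow>\<^sub>M PiM A (\<lambda>_. lborel)"
      by (intro measurable_restrict) simp
    have "(\<integral>\<^sup>+x. f (T (merge B A (y, x))) \<partial>PiM A (\<lambda>_. lborel)) =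
      (\<integral>\<^sup>+x. f (merge B A (y, x)) \<partial>distr (PiM A (\<lambda>_. lborel)) (PiM A (\<lambda>_. lborel)) (\<lambda>x. \<lambda>i\<in>A. x i + g y i))"
      unfolding eq by (rule nn_integral_distr[symmetric]) (use mm[OF y] in measurable)
    then show "(\<integral>\<^sup>+x. f (T (merge B A (y, x))) \<partial>PiM A (\<lambda>_. lborel)) =
      (\<integral>\<^sup>+x. f (merge B A (y, x)) \<partial>PiM A (\<lambda>_. lborel))"
      by (simp add: distr_PiM_lborel_translate fin)
  qed
  also have "\<dots> = (\<integral>\<^sup>+x. f x \<partial>PiM (A \<union> B) (\<lambda>_. lborel))"
    by (rule fold[symmetric]) (rule f)
  finally show ?thesis by (simp add: T_def)
qed

section \<open>The squared modulus of a standard complex Gaussian is exponential\<close>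

lemma sets_CN01 [measurable_cong, simp]: "sets CN01 = sets borel"
  by (simp add: CN01_def)

lemma space_CN01 [simp]: "space CN01 = UNIV"
  by (simp add: CN01_def)

lemma emeasure_lborel_disc:
  assumes "0 \<le> a"
  shows "emeasure lborel {z::complex. (cmod z)\<^sup>2 < a} = ennreal (pi * a)"
proof -
  have "{z::complex. (cmod z)\<^sup>2 < a} = ball 0 (sqrt a)"
    using assms by (auto simp: dist_norm intro: real_less_rsqrt)
      (metis norm_ge_zero real_sqrt_less_iff real_sqrt_abs abs_of_nonneg)
  then show ?thesis
    using assms by (simp add: emeasure_ball unit_ball_vol_2 DIM_complex)
qed

text \<open>Layer-cake argument in place of polar coordinates: the density is written as the
  integral of \<open>exp (- u)\<close> over u > |z|^2. After exchanging the integrals, the inner one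
  is the area pi (u - a) of an annulus.\<close>

lemma emeasure_CN01_norm_squared_ge:
  assumes a: "0 \<le> a"
  shows "emeasure CN01 {z. a \<le> (cmod z)\<^sup>2} = ennreal (exp (- a))"
proof -
  have exp_tail: "ennreal (exp (- c)) = (\<integral>\<^sup>+u. indicator {c<..} u * ennreal (exp (- u)) \<partial>lborel)" for c :: real
  proof -
    have "(\<integral>\<^sup>+u. ennreal (exp (- u)) * indicator {c..} u \<partial>lborel) = ennreal (0 - (- exp (- c)))"
      by (rule nn_integral_FTC_atLeast[where F = "\<lambda>u. - exp (- u)"])
        (auto intro!: derivative_eq_intros, real_asymp)
    \<comment> \<open>The fundamental theorem is applied on a closed half-line. Passing to the open
      one costs a null set and makes the annulus below a difference of two open discs.\<close>
    moreover have "(\<integral>\<^sup>+u. ennreal (exp (- u)) * indicator {c..} u \<partial>lborel) =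
        (\<integral>\<^sup>+u. indicator {c<..} u * ennreal (exp (- u)) \<partial>lborel)"
    proof (rule nn_integral_cong_AE)
      show "AE u in lborel. ennreal (exp (- u)) * indicator {c..} u = indicator {c<..} u * ennreal (exp (- u))"
        using AE_lborel_singleton[of c] by eventually_elim (auto split: split_indicator)
    qed
    ultimately show ?thesis by simp
  qed
  have "emeasure CN01 {z. a \<le> (cmod z)\<^sup>2} =
    (\<integral>\<^sup>+z. ennreal (1 / pi) * (indicator {z. a \<le> (cmod z)\<^sup>2} z * ennreal (exp (- (cmod z)\<^sup>2))) \<partial>lborel)"
    unfolding CN01_def
    by (subst emeasure_density) (auto intro!: nn_integral_cong split: split_indicator simp: ennreal_mult'[symmetric] divide_inverse mult_ac)
  also have "\<dots> = ennreal (1 / pi) * (\<integral>\<^sup>+z. indicator {z. a \<le> (cmod z)\<^sup>2} z * ennreal (exp (- (cmod z)\<^sup>2)) \<partial>lborel)"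
    by (rule nn_integral_cmult) measurable
  also have "(\<integral>\<^sup>+z. indicator {z. a \<le> (cmod z)\<^sup>2} z * ennreal (exp (- (cmod z)\<^sup>2)) \<partial>lborel) =
     (\<integral>\<^sup>+z. \<integral>\<^sup>+u. indicator {z. a \<le> (cmod z)\<^sup>2} z * (indicator {(cmod z)\<^sup>2<..} u * ennreal (exp (- u))) \<partial>lborel \<partial>lborel)"
    by (subst nn_integral_cmult) (simp_all flip: exp_tail)
  also have "\<dots> = (\<integral>\<^sup>+z. \<integral>\<^sup>+u. (indicator {(z::complex, u). a \<le> (cmod z)\<^sup>2 \<and> (cmod z)\<^sup>2 < u} (z, u)) * ennreal (exp (- u)) \<partial>lborel \<partial>lborel)"
    by (intro nn_integral_cong) (auto split: split_indicator)
  also have "\<dots> = (\<integral>\<^sup>+u. \<integral>\<^sup>+z. (indicator {(z::complex, u). a \<le> (cmod z)\<^sup>2 \<and> (cmod z)\<^sup>2 < u} (z, u)) * ennreal (exp (- u)) \<partial>lborel \<partial>lborel)"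
    by (rule lborel_pair.Fubini'[symmetric]) measurable
  also have "\<dots> = (\<integral>\<^sup>+u. ennreal (pi * (u - a) * exp (- u)) * indicator {a..} u \<partial>lborel)"
  proof (rule nn_integral_cong)
    fix u :: real
    have "(\<integral>\<^sup>+z. (indicator {(z::complex, u). a \<le> (cmod z)\<^sup>2 \<and> (cmod z)\<^sup>2 < u} (z, u)) * ennreal (exp (- u)) \<partial>lborel) =
       (\<integral>\<^sup>+z. indicator {z::complex. a \<le> (cmod z)\<^sup>2 \<and> (cmod z)\<^sup>2 < u} z * ennreal (exp (- u)) \<partial>lborel)"
      by (auto intro!: nn_integral_cong split: split_indicator)
    also have "\<dots> = emeasure lborel {z::complex. a \<le> (cmod z)\<^sup>2 \<and> (cmod z)\<^sup>2 < u} * ennreal (exp (- u))"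
      by (subst nn_integral_multc) (auto intro!: nn_integral_indicator)
    also have "\<dots> = ennreal (pi * (u - a) * exp (- u)) * indicator {a..} u"
    proof (cases "a \<le> u")
      case True
      have "{z::complex. a \<le> (cmod z)\<^sup>2 \<and> (cmod z)\<^sup>2 < u} = {z. (cmod z)\<^sup>2 < u} - {z. (cmod z)\<^sup>2 < a}" by auto
      moreover have "emeasure lborel ({z::complex. (cmod z)\<^sup>2 < u} - {z. (cmod z)\<^sup>2 < a}) =
         emeasure lborel {z::complex. (cmod z)\<^sup>2 < u} - emeasure lborel {z::complex. (cmod z)\<^sup>2 < a}"
        using True a by (intro emeasure_Diff) (auto simp: emeasure_lborel_disc)
      ultimately have "emeasure lborel {z::complex. a \<le> (cmod z)\<^sup>2 \<and> (cmod z)\<^sup>2 < u} =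
         emeasure lborel {z::complex. (cmod z)\<^sup>2 < u} - emeasure lborel {z::complex. (cmod z)\<^sup>2 < a}"
        by simp
      also have "\<dots> = ennreal (pi * (u - a))"
        using True a by (simp add: emeasure_lborel_disc ennreal_minus right_diff_distrib)
      finally show ?thesis using True by (simp add: ennreal_mult')
    next
      case False
      then have empty: "{z::complex. a \<le> (cmod z)\<^sup>2 \<and> (cmod z)\<^sup>2 < u} = {}" by auto
      show ?thesis unfolding empty using False by simp
    qed
    finally show "(\<integral>\<^sup>+z. (indicator {(z::complex, u). a \<le> (cmod z)\<^sup>2 \<and> (cmod z)\<^sup>2 < u} (z, u)) * ennreal (exp (- u)) \<partial>lborel) =
      ennreal (pi * (u - a) * exp (- u)) * indicator {a..} u" .
  qed
  \<comment> \<open>The primitive of pi (u - a) exp(-u) used here vanishes at infinity and equals -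
    pi exp(-a) at u = a; the factor pi cancels the normalisation of the density.\<close>
  also have "\<dots> = ennreal (0 - (- pi * exp (- a)))"
  proof (rule nn_integral_FTC_atLeast[where F = "\<lambda>u. - pi * (u - a + 1) * exp (- u)", THEN trans])
    show "((\<lambda>u. - pi * (u - a + 1) * exp (- u)) \<longlongrightarrow> 0) at_top" by real_asymp
  qed (auto intro!: derivative_eq_intros simp: algebra_simps)
  finally show ?thesis by (simp add: ennreal_mult'[symmetric])
qed

lemma prob_space_CN01: "prob_space CN01"
  using emeasure_CN01_norm_squared_ge[of 0] by (intro prob_spaceI) simp

lemma distributed_CN01_norm_squared:
  "distributed CN01 lborel (\<lambda>z. (cmod z)\<^sup>2) (exponential_density 1)"
proof -
  interpret prob_space CN01 by (rule prob_space_CN01)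
  show ?thesis
  proof (subst exponential_distributed_iff, simp, intro conjI allI impI)
    fix a :: real assume a: "0 \<le> a"
    \<comment> \<open>The characterisation of the exponential law uses P(X <= a), whereas the
      computed tail is P(X >= a). The two are complementary up to the circle |z|^2 = a, a null
      set.\<close>
    have "AE z in CN01. (cmod z)\<^sup>2 \<noteq> a"
    proof -
      have "AE z in (lborel :: complex measure). z \<notin> sphere 0 (sqrt a)"
        by (rule AE_not_in) (use negligible_sphere[of "0::complex" "sqrt a"] in \<open>simp add: negligible_iff_null_sets null_sets_completion_iff\<close>)
      then have "AE z in (lborel :: complex measure). (cmod z)\<^sup>2 \<noteq> a"
        by eventually_elim (auto simp: dist_norm)
      then show ?thesis unfolding CN01_def by (subst AE_density) auto
    qed
    then have "prob {z \<in> space CN01. (cmod z)\<^sup>2 \<le> a} = prob (space CN01 - {z. a \<le> (cmod z)\<^sup>2})"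
      by (intro finite_measure_eq_AE) (auto elim!: eventually_mono)
    also have "\<dots> = 1 - prob {z. a \<le> (cmod z)\<^sup>2}" by (rule prob_compl) simp
    also have "prob {z. a \<le> (cmod z)\<^sup>2} = exp (- a)"
      using emeasure_CN01_norm_squared_ge[OF a] by (simp add: measure_def)
    finally show "\<P>(z in CN01. (cmod z)\<^sup>2 \<le> a) = 1 - exp (- a * 1)" by simp
  qed simp
qed

subsection \<open>Moments of the logarithm\<close>

text \<open>The \<open>k\<close>-th power of u <= exp u at u = e |y| / k. The two-sided exponential
  removes the absolute value, so powers of a variable are controlled by its exponential moments on
  both sides.\<close>

lemma abs_power_le_exp:
  fixes y e :: real
  assumes "0 < e"
  shows "\<bar>y\<bar> ^ k \<le> (real k / e) ^ k * (exp (e * y) + exp (- e * y))"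
proof -
  have "\<bar>y\<bar> ^ k \<le> (real k / e) ^ k * exp (e * \<bar>y\<bar>)"
  proof (cases "k = 0")
    case False
    then have "\<bar>y\<bar> = (real k / e) * (e * \<bar>y\<bar> / real k)" using assms by simp
    also have "\<dots> \<le> (real k / e) * exp (e * \<bar>y\<bar> / real k)"
    proof (intro mult_left_mono)
      show "e * \<bar>y\<bar> / real k \<le> exp (e * \<bar>y\<bar> / real k)"
        using exp_ge_add_one_self[of "e * \<bar>y\<bar> / real k"] by linarith
    qed (use assms in auto)
    finally have "\<bar>y\<bar> ^ k \<le> ((real k / e) * exp (e * \<bar>y\<bar> / real k)) ^ k"
      by (intro power_mono) auto
    also have "\<dots> = (real k / e) ^ k * exp (e * \<bar>y\<bar>)"
      unfolding power_mult_distrib using False by (simp flip: exp_of_nat_mult)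
    finally show ?thesis .
  qed (use assms in auto)
  also have "\<dots> \<le> (real k / e) ^ k * (exp (e * y) + exp (- e * y))"
    using assms by (intro mult_left_mono) (auto simp: abs_if)
  finally show ?thesis .
qed

text \<open>Serves to dominate difference quotients of exp(h Y): the factor
  \<open>\<bar>u\<bar>\<close> cancels the denominator h.\<close>

lemma abs_exp_minus_one_le:
  fixes u :: real
  shows "\<bar>exp u - 1\<bar> \<le> \<bar>u\<bar> * exp \<bar>u\<bar>"
proof (cases "0 \<le> u")
  case True
  have "(1 - u) * exp u \<le> exp (- u) * exp u"
    using exp_ge_add_one_self[of "- u"] by (intro mult_right_mono) auto
  then show ?thesis using True by (simp add: algebra_simps flip: exp_add)
next
  case False
  have "1 - exp u \<le> - u" using exp_ge_add_one_self[of u] by linarith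
  then have "\<bar>exp u - 1\<bar> \<le> \<bar>u\<bar> * 1" using False by simp
  also have "\<dots> \<le> \<bar>u\<bar> * exp \<bar>u\<bar>" by (intro mult_left_mono) auto
  finally show ?thesis .
qed

lemma exp_plus_minus:
  fixes s e y :: real
  shows "exp ((s + e) * y) = exp (s * y) * exp (e * y)" "exp ((s - e) * y) = exp (s * y) * exp (- (e * y))"
  by (simp_all add: distrib_right left_diff_distrib exp_add exp_diff exp_minus divide_inverse)

lemma integrable_power_mult_exp:
  fixes Y :: "'a \<Rightarrow> real"
  assumes [measurable]: "Y \<in> borel_measurable M"
    and int: "\<And>s. \<bar>s\<bar> < d \<Longrightarrow> integrable M (\<lambda>x. exp (s * Y x))"
    and s: "\<bar>s\<bar> < d"
  shows "integrable M (\<lambda>x. Y x ^ k * exp (s * Y x))"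
proof -
  \<comment> \<open>Half the distance from |s| to \<open>d\<close>: both s + e and s - e stay inside
    the interval on which exponential moments exist, and the power of \<open>Y\<close> is absorbed
    by exp(e Y) + exp(-e Y).\<close>
  define e where "e = (d - \<bar>s\<bar>) / 2"
  have e: "0 < e" "\<bar>s + e\<bar> < d" "\<bar>s - e\<bar> < d" using s unfolding e_def by (auto simp: abs_if field_simps split: if_splits)
  show ?thesis
  proof (rule Bochner_Integration.integrable_bound)
    show "integrable M (\<lambda>x. (real k / e) ^ k * (exp ((s + e) * Y x) + exp ((s - e) * Y x)))"
      using int e by auto
    show "AE x in M. norm (Y x ^ k * exp (s * Y x)) \<le>
        norm ((real k / e) ^ k * (exp ((s + e) * Y x) + exp ((s - e) * Y x)))"
    proof (rule AE_I2)
      fix x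
      have "norm (Y x ^ k * exp (s * Y x)) = \<bar>Y x\<bar> ^ k * exp (s * Y x)" by (simp add: abs_mult power_abs)
      also have "\<dots> \<le> (real k / e) ^ k * (exp (e * Y x) + exp (- e * Y x)) * exp (s * Y x)"
        by (intro mult_right_mono abs_power_le_exp e) auto
      also have "\<dots> = (real k / e) ^ k * (exp ((s + e) * Y x) + exp ((s - e) * Y x))"
        unfolding exp_plus_minus by (simp add: algebra_simps)
      also have "\<dots> \<le> norm ((real k / e) ^ k * (exp ((s + e) * Y x) + exp ((s - e) * Y x)))" by simp
      finally show "norm (Y x ^ k * exp (s * Y x)) \<le> \<dots>" .
    qed
  qed measurable
qed

text \<open>Differentiation under the integral sign by dominated convergence. For increments below
  \<open>e\<close> in modulus, all difference quotients have the common integrable majorant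
  |Y|^(k+1) (exp((s+e) Y) + exp((s-e) Y)).\<close>

lemma has_field_derivative_integral_power_mult_exp:
  fixes Y :: "'a \<Rightarrow> real"
  assumes Y [measurable]: "Y \<in> borel_measurable M"
    and int: "\<And>s. \<bar>s\<bar> < d \<Longrightarrow> integrable M (\<lambda>x. exp (s * Y x))"
    and s: "\<bar>s\<bar> < d"
  shows "((\<lambda>s. \<integral>x. Y x ^ k * exp (s * Y x) \<partial>M) has_field_derivative
    (\<integral>x. Y x ^ Suc k * exp (s * Y x) \<partial>M)) (at s)"
proof -
  define e where "e = (d - \<bar>s\<bar>) / 2"
  have e: "0 < e" "\<bar>s + e\<bar> < d" "\<bar>s - e\<bar> < d" using s unfolding e_def by (auto simp: abs_if field_simps split: if_splits)
  note int' = integrable_power_mult_exp[OF Y int]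
  define q where "q = (\<lambda>h x. (Y x ^ k * exp ((s + h) * Y x) - Y x ^ k * exp (s * Y x)) / h)"
  \<comment> \<open>Restricting the increments to this interval makes the majorant valid for every
    term of a sequence, not just eventually; the interval is open around 0, so the limit is the
    same.\<close>
  let ?I = "{-e<..<e}"
  have "((\<lambda>h. ((\<integral>x. Y x ^ k * exp ((s + h) * Y x) \<partial>M) - (\<integral>x. Y x ^ k * exp (s * Y x) \<partial>M)) / h)
      \<longlongrightarrow> (\<integral>x. Y x ^ Suc k * exp (s * Y x) \<partial>M)) (at 0 within ?I)"
    unfolding tendsto_at_iff_sequentially
  proof (intro allI impI)
    fix H assume H: "\<forall>i. H i \<in> ?I - {0}" and lim: "H \<longlonglongrightarrow> (0::real)"
    have Hd: "\<bar>s + H i\<bar> < d" for i using H[rule_format, of i] e by auto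
    have "(\<lambda>i. \<integral>x. q (H i) x \<partial>M) \<longlonglongrightarrow> (\<integral>x. Y x ^ Suc k * exp (s * Y x) \<partial>M)"
    proof (rule integral_dominated_convergence)
      show "integrable M (\<lambda>x. norm (Y x ^ Suc k * exp ((s + e) * Y x)) + norm (Y x ^ Suc k * exp ((s - e) * Y x)))"
        by (intro Bochner_Integration.integrable_add integrable_norm int') (use e in auto)
      show "AE x in M. (\<lambda>i. q (H i) x) \<longlonglongrightarrow> Y x ^ Suc k * exp (s * Y x)"
      proof (rule AE_I2)
        fix x
        have "((\<lambda>s. Y x ^ k * exp (s * Y x)) has_field_derivative Y x ^ Suc k * exp (s * Y x)) (at s)"
          by (auto intro!: derivative_eq_intros)
        then have "((\<lambda>h. q h x) \<longlongrightarrow> Y x ^ Suc k * exp (s * Y x)) (at 0)"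
          by (simp add: DERIV_def q_def)
        then show "(\<lambda>i. q (H i) x) \<longlonglongrightarrow> Y x ^ Suc k * exp (s * Y x)"
          using H lim by (auto simp: tendsto_at_iff_sequentially comp_def)
      qed
      show "AE x in M. norm (q (H i) x) \<le> norm (Y x ^ Suc k * exp ((s + e) * Y x)) +
          norm (Y x ^ Suc k * exp ((s - e) * Y x))" for i
      proof (rule AE_I2)
        fix x
        define h where "h = H i"
        have h: "\<bar>h\<bar> \<le> e" "h \<noteq> 0" using H[rule_format, of i] by (auto simp: h_def)
        have q_eq: "q h x = Y x ^ k * exp (s * Y x) * (exp (h * Y x) - 1) / h"
          by (simp add: q_def algebra_simps exp_add)
        have "norm (q h x) = \<bar>Y x\<bar> ^ k * exp (s * Y x) * \<bar>exp (h * Y x) - 1\<bar> / \<bar>h\<bar>"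
          unfolding q_eq by (simp add: abs_mult power_abs)
        also have "\<dots> \<le> \<bar>Y x\<bar> ^ k * exp (s * Y x) * (\<bar>h * Y x\<bar> * exp \<bar>h * Y x\<bar>) / \<bar>h\<bar>"
          by (intro mult_left_mono divide_right_mono abs_exp_minus_one_le) auto
        also have "\<dots> = \<bar>Y x\<bar> ^ Suc k * exp (s * Y x) * exp \<bar>h * Y x\<bar>"
          using h by (simp add: abs_mult)
        also have "\<dots> \<le> \<bar>Y x\<bar> ^ Suc k * exp (s * Y x) * (exp (e * Y x) + exp (- e * Y x))"
        proof (intro mult_left_mono)
          have "exp \<bar>h * Y x\<bar> \<le> exp (e * \<bar>Y x\<bar>)" using h by (simp add: abs_mult mult_right_mono)
          also have "\<dots> \<le> exp (e * Y x) + exp (- e * Y x)" by (auto simp: abs_if)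
          finally show "exp \<bar>h * Y x\<bar> \<le> exp (e * Y x) + exp (- e * Y x)" .
        qed auto
        also have "\<dots> = norm (Y x ^ Suc k * exp ((s + e) * Y x)) + norm (Y x ^ Suc k * exp ((s - e) * Y x))"
          unfolding exp_plus_minus by (simp add: abs_mult power_abs algebra_simps)
        finally show "norm (q (H i) x) \<le> norm (Y x ^ Suc k * exp ((s + e) * Y x)) +
          norm (Y x ^ Suc k * exp ((s - e) * Y x))" by (simp add: h_def)
      qed
    qed (auto simp: q_def)
    moreover have "(\<integral>x. q (H i) x \<partial>M) =
       ((\<integral>x. Y x ^ k * exp ((s + H i) * Y x) \<partial>M) - (\<integral>x. Y x ^ k * exp (s * Y x) \<partial>M)) / H i" for i
      unfolding q_def using int'[OF _ Hd] int'[OF _ s] by simp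
    ultimately show "((\<lambda>h. ((\<integral>x. Y x ^ k * exp ((s + h) * Y x) \<partial>M) - (\<integral>x. Y x ^ k * exp (s * Y x) \<partial>M)) / h) \<circ> H)
      \<longlonglongrightarrow> (\<integral>x. Y x ^ Suc k * exp (s * Y x) \<partial>M)"
      by (simp add: comp_def)
  qed
  moreover have "at 0 within ?I = at 0" using e by (intro at_within_open) auto
  ultimately show ?thesis by (simp add: DERIV_def)
qed

text \<open>Here \<open>v\<close> is the variance of the logarithm, encoded through the second raw
  moment. Almost sure positivity is carried along because it makes the logarithm of a product
  additive.\<close>

definition log_moments :: "real measure \<Rightarrow> real \<Rightarrow> real \<Rightarrow> bool" where
  "log_moments M m v \<longleftrightarrow> prob_space M \<and> sets M = sets borel \<and> (AE x in M. 0 < x) \<and>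
    integrable M ln \<and> integrable M (\<lambda>x. (ln x)\<^sup>2) \<and>
    (\<integral>x. ln x \<partial>M) = m \<and> (\<integral>x. (ln x)\<^sup>2 \<partial>M) = v + m\<^sup>2"

lemma nn_integral_erlang_density_exp_ln:
  assumes "- 1 - real n < s"
  shows "(\<integral>\<^sup>+x. ennreal (exp (s * ln x)) \<partial>density lborel (erlang_density n 1)) =
    ennreal (Gamma (real n + 1 + s) / fact n)"
proof -
  have "(\<integral>\<^sup>+x. ennreal (exp (s * ln x)) \<partial>density lborel (erlang_density n 1)) =
    (\<integral>\<^sup>+x. ennreal (erlang_density n 1 x) * ennreal (exp (s * ln x)) \<partial>lborel)"
    by (subst nn_integral_density) auto
  also have "\<dots> = (\<integral>\<^sup>+x. ennreal (1 / fact n) *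
      ennreal (indicator {0..} x * x powr (real n + 1 + s - 1) / exp x) \<partial>lborel)"
  \<comment> \<open>The point 0 must be discarded: there \<open>x powr s\<close> is 0 while
    \<open>exp (s * ln x)\<close> is positive.\<close>
  proof (rule nn_integral_cong_AE)
    show "AE x in lborel. ennreal (erlang_density n 1 x) * ennreal (exp (s * ln x)) =
      ennreal (1 / fact n) * ennreal (indicator {0..} x * x powr (real n + 1 + s - 1) / exp x)"
      using AE_lborel_singleton[of "0::real"]
    proof eventually_elim
      case (elim x)
      show ?case
      proof (cases "x < 0")
        case False
        then have "x ^ n = x powr real n" "exp (s * ln x) = x powr s"
          using elim powr_realpow[of x n] by (simp, simp add: powr_def)
        then show ?thesis using False elim
          by (simp add: erlang_density_def powr_add exp_minus divide_simps flip: ennreal_mult')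
      qed (simp add: erlang_density_def)
    qed
  qed
  also have "\<dots> = ennreal (1 / fact n) * ennreal (Gamma (real n + 1 + s))"
    using assms by (subst nn_integral_cmult) (auto simp: Gamma_conv_nn_integral_real)
  finally show ?thesis by (simp flip: ennreal_mult')
qed

text \<open>\<open>erlang_density n 1\<close> is the Gamma law with parameter n + 1. Its moment
  function in \<open>s\<close> is Gamma(n+1+s)/n!, and its derivatives are computed twice, under the
  integral and through Gamma' = Gamma psi; uniqueness of derivatives equates the results.\<close>

lemma log_moments_erlang:
  "log_moments (density lborel (erlang_density n 1)) (Digamma (real n + 1)) (Polygamma 1 (real n + 1))"
proof -
  let ?M = "density lborel (\<lambda>x. ennreal (erlang_density n 1 x))"
  interpret prob_space ?M by (rule prob_space_erlang_density) simp
  have Gpos: "0 < Gamma (real n + 1 + s)" if "\<bar>s\<bar> < 1" for s :: real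
    using that by (intro Gamma_real_pos) auto
  have nonpos: "real n + 1 + s \<notin> \<int>\<^sub>\<le>\<^sub>0" if "\<bar>s\<bar> < 1" for s :: real
    using that by (auto simp: nonpos_Ints_def)
  have hb: "has_bochner_integral ?M (\<lambda>x. exp (s * ln x)) (Gamma (real n + 1 + s) / fact n)"
    if "\<bar>s\<bar> < 1" for s
  proof (rule has_bochner_integral_nn_integral)
    show "(\<integral>\<^sup>+x. ennreal (exp (s * ln x)) \<partial>?M) = ennreal (Gamma (real n + 1 + s) / fact n)"
      using that by (intro nn_integral_erlang_density_exp_ln) auto
    show "0 \<le> Gamma (real n + 1 + s) / fact n" using Gpos[OF that] by simp
  qed auto
  have meas: "(ln :: real \<Rightarrow> real) \<in> borel_measurable ?M" by simp
  have int: "integrable ?M (\<lambda>x. exp (s * ln x))" if "\<bar>s\<bar> < 1" for s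
    using hb[OF that] by (simp add: has_bochner_integral_iff)
  have deriv: "((\<lambda>s. \<integral>x. ln x ^ k * exp (s * ln x) \<partial>?M) has_field_derivative
      (\<integral>x. ln x ^ Suc k * exp (s * ln x) \<partial>?M)) (at s)" if "\<bar>s\<bar> < 1" for s k
    by (rule has_field_derivative_integral_power_mult_exp[where d = 1, OF meas int that])
  have intk: "integrable ?M (\<lambda>x. ln x ^ k * exp (0 * ln x))" for k
    by (rule integrable_power_mult_exp[where d = 1, OF meas int]) auto
  have op: "open {-1<..<1::real}" by simp
  have phi0: "(\<integral>x. ln x ^ 0 * exp (s * ln x) \<partial>?M) = Gamma (real n + 1 + s) / fact n" if "\<bar>s\<bar> < 1" for s
    using hb[OF that] by (simp add: has_bochner_integral_iff)
  \<comment> \<open>Needed on the whole interval and not only at 0, since this identity is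
    differentiated once more.\<close>
  have phi1: "(\<integral>x. ln x ^ 1 * exp (s * ln x) \<partial>?M) =
      Gamma (real n + 1 + s) * Digamma (real n + 1 + s) / fact n" if s: "\<bar>s\<bar> < 1" for s
  proof (rule DERIV_unique)
    show "((\<lambda>s. Gamma (real n + 1 + s) / fact n) has_field_derivative
      (\<integral>x. ln x ^ 1 * exp (s * ln x) \<partial>?M)) (at s)"
    proof (rule has_field_derivative_transform_within_open[OF _ op])
      show "((\<lambda>s. \<integral>x. ln x ^ 0 * exp (s * ln x) \<partial>?M) has_field_derivative
        (\<integral>x. ln x ^ 1 * exp (s * ln x) \<partial>?M)) (at s)"
        using deriv[OF s, of 0] by (simp only: One_nat_def)
      show "s \<in> {-1<..<1}" using s by auto
      show "(\<integral>x. ln x ^ 0 * exp (s * ln x) \<partial>?M) = Gamma (real n + 1 + s) / fact n"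
        if "s \<in> {-1<..<1}" for s using that by (intro phi0) auto
    qed
    show "((\<lambda>s. Gamma (real n + 1 + s) / fact n) has_field_derivative
      Gamma (real n + 1 + s) * Digamma (real n + 1 + s) / fact n) (at s)"
      using nonpos[OF s] by (auto intro!: derivative_eq_intros)
  qed
  have phi2: "(\<integral>x. ln x ^ 2 * exp (0 * ln x) \<partial>?M) =
      (Gamma (real n + 1) * Polygamma 1 (real n + 1) +
       Gamma (real n + 1) * Digamma (real n + 1) * Digamma (real n + 1)) / fact n"
  proof (rule DERIV_unique)
    show "((\<lambda>s. Gamma (real n + 1 + s) * Digamma (real n + 1 + s) / fact n) has_field_derivative
      (\<integral>x. ln x ^ 2 * exp (0 * ln x) \<partial>?M)) (at 0)"
    proof (rule has_field_derivative_transform_within_open[OF _ op])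
      show "((\<lambda>s. \<integral>x. ln x ^ 1 * exp (s * ln x) \<partial>?M) has_field_derivative
        (\<integral>x. ln x ^ 2 * exp (0 * ln x) \<partial>?M)) (at 0)"
        using deriv[of 0 1] by (simp only: Suc_1 abs_zero zero_less_one)
      show "(\<integral>x. ln x ^ 1 * exp (s * ln x) \<partial>?M) = Gamma (real n + 1 + s) * Digamma (real n + 1 + s) / fact n"
        if "s \<in> {-1<..<1}" for s using that by (intro phi1) auto
    qed simp
    show "((\<lambda>s. Gamma (real n + 1 + s) * Digamma (real n + 1 + s) / fact n) has_field_derivative
      (Gamma (real n + 1) * Polygamma 1 (real n + 1) +
       Gamma (real n + 1) * Digamma (real n + 1) * Digamma (real n + 1)) / fact n) (at 0)"
      using nonpos[of 0] by (auto intro!: derivative_eq_intros)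
  qed
  have G: "Gamma (1 + real n) = fact n" by (rule Gamma_fact)
  have pos: "AE x in ?M. 0 < x"
    using AE_lborel_singleton[of "0::real"]
    by (subst AE_density) (auto simp: erlang_density_def elim!: eventually_mono split: if_splits)
  show ?thesis
    unfolding log_moments_def
    using phi1[of 0] phi2 pos prob_space_axioms
intk[of 1] intk[of 2]
    by (simp add: G add.commute power2_eq_square add_divide_distrib)
qed

text \<open>Under the product measure the factors are independent. Means of logarithms add, and the
  cross term 2 m m' of the second moment completes the square (m + m')^2, so variances add as
  well.\<close>

lemma log_moments_mult:
  assumes "log_moments M m v" "log_moments N m' v'"
  shows "log_moments (distr (M \<Otimes>\<^sub>M N) borel (\<lambda>(x, y). x * y)) (m + m') (v + v')"
proof -
  have [measurable_cong]: "sets M = sets borel" "sets N = sets borel"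
    and M: "prob_space M" "AE x in M. 0 < x" "integrable M ln" "integrable M (\<lambda>x. (ln x)\<^sup>2)"
      "(\<integral>x. ln x \<partial>M) = m" "(\<integral>x. (ln x)\<^sup>2 \<partial>M) = v + m\<^sup>2"
    and N: "prob_space N" "AE x in N. 0 < x" "integrable N ln" "integrable N (\<lambda>x. (ln x)\<^sup>2)"
      "(\<integral>x. ln x \<partial>N) = m'" "(\<integral>x. (ln x)\<^sup>2 \<partial>N) = v' + m'\<^sup>2"
    using assms by (auto simp: log_moments_def)
  interpret M: prob_space M by fact
  interpret N: prob_space N by fact
  interpret pair_prob_space M N ..
  let ?P = "M \<Otimes>\<^sub>M N"
  have fst_distr: "distr ?P M fst = M" by (rule N.distr_pair_fst)
  have snd_distr: "distr ?P N snd = N"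
    by (subst distr_pair_swap) (simp add: distr_distr comp_def split_beta M.distr_pair_fst)
  have fst: "integrable ?P (\<lambda>p. f (fst p))" "(\<integral>p. f (fst p) \<partial>?P) = (\<integral>x. f x \<partial>M)"
    if "integrable M f" for f :: "real \<Rightarrow> real"
    using that integrable_distr_eq[of fst ?P M f] integral_distr[of fst ?P M f] by (auto simp: fst_distr)
  have snd: "integrable ?P (\<lambda>p. f (snd p))" "(\<integral>p. f (snd p) \<partial>?P) = (\<integral>x. f x \<partial>N)"
    if "integrable N f" for f :: "real \<Rightarrow> real"
    using that integrable_distr_eq[of snd ?P N f] integral_distr[of snd ?P N f] by (auto simp: snd_distr)
  have cross: "integrable ?P (\<lambda>p. ln (fst p) * ln (snd p))"
  proof (rule Fubini_integrable)
    have "integrable M (\<lambda>x. \<bar>ln x\<bar> * (\<integral>y. \<bar>ln y\<bar> \<partial>N))"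
      using M(3) by (intro integrable_mult_left) auto
    then show "integrable M (\<lambda>x. \<integral>y. norm (ln (fst (x, y)) * ln (snd (x, y))) \<partial>N)"
      by (simp add: abs_mult)
    show "AE x in M. integrable N (\<lambda>y. ln (fst (x, y)) * ln (snd (x, y)))"
      using N(3) by auto
  qed measurable
  have cross_int: "(\<integral>p. ln (fst p) * ln (snd p) \<partial>?P) = m * m'"
    using integral_fst'[OF cross] M(3,5) N(3,5) by simp
  have pos: "AE p in ?P. 0 < fst p \<and> 0 < snd p"
  proof (rule AE_conjI)
    have "AE x in distr ?P M fst. 0 < x" unfolding fst_distr by (rule M(2))
    then show "AE p in ?P. 0 < fst p" by (rule AE_distrD[rotated]) measurable
    have "AE x in distr ?P N snd. 0 < x" unfolding snd_distr by (rule N(2))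
    then show "AE p in ?P. 0 < snd p" by (rule AE_distrD[rotated]) measurable
  qed
  have 1: "has_bochner_integral ?P (\<lambda>p. ln (fst p * snd p)) (m + m')"
  proof (rule has_bochner_integral_cong_AE[THEN iffD2])
    show "AE p in ?P. ln (fst p * snd p) = ln (fst p) + ln (snd p)"
      using pos by eventually_elim (simp add: ln_mult)
    show "has_bochner_integral ?P (\<lambda>p. ln (fst p) + ln (snd p)) (m + m')"
      using fst[OF M(3)] snd[OF N(3)] M(5) N(5) by (simp add: has_bochner_integral_iff)
  qed measurable
  have 2: "has_bochner_integral ?P (\<lambda>p. (ln (fst p * snd p))\<^sup>2) (v + v' + (m + m')\<^sup>2)"
  proof (rule has_bochner_integral_cong_AE[THEN iffD2])
    show "AE p in ?P. (ln (fst p * snd p))\<^sup>2 = (ln (fst p))\<^sup>2 + (ln (snd p))\<^sup>2 + 2 * (ln (fst p) * ln (snd p))"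
      using pos by eventually_elim (simp add: ln_mult power2_eq_square algebra_simps)
    show "has_bochner_integral ?P (\<lambda>p. (ln (fst p))\<^sup>2 + (ln (snd p))\<^sup>2 + 2 * (ln (fst p) * ln (snd p)))
      (v + v' + (m + m')\<^sup>2)"
      using fst[OF M(4)] snd[OF N(4)] M(6) N(6) cross cross_int
      by (simp add: has_bochner_integral_iff power2_eq_square algebra_simps)
  qed measurable
  show ?thesis
    unfolding log_moments_def
  proof (intro conjI)
    show "prob_space (distr ?P borel (\<lambda>(x, y). x * y))" by (rule prob_space_distr) measurable
    show "AE x in distr ?P borel (\<lambda>(x, y). x * y). 0 < x"
    proof (subst AE_distr_iff)
      show "AE p in ?P. 0 < (case p of (x, y) \<Rightarrow> x * y)"
        using pos by eventually_elim (auto simp: split_beta)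
    qed measurable
  qed (use 1 2 in \<open>simp_all add: integrable_distr_eq integral_distr has_bochner_integral_iff split_beta\<close>)
qed

subsection \<open>Unitary invariance\<close>

text \<open>Splits Gaussian invariance into invariance of Lebesgue measure and invariance of the
  density. Both sides are compared on boxes.\<close>

lemma PiM_CN01_eq_density:
  assumes [simp]: "finite I"
  shows "PiM I (\<lambda>_. CN01) =
    density (PiM I (\<lambda>_. lborel)) (\<lambda>x. \<Prod>i\<in>I. ennreal (exp (- (cmod (x i))\<^sup>2) / pi))"
proof -
  interpret CN: product_sigma_finite "\<lambda>_::'a. CN01"
    by (simp add: product_sigma_finite_def prob_space_imp_sigma_finite prob_space_CN01)
  interpret L: product_sigma_finite "\<lambda>_::'a. lborel :: complex measure" by standard
  show ?thesis
  proof (rule CN.PiM_eqI[symmetric])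
    show "sets (density (PiM I (\<lambda>_. lborel)) (\<lambda>x. \<Prod>i\<in>I. ennreal (exp (- (cmod (x i))\<^sup>2) / pi))) =
      sets (PiM I (\<lambda>_. CN01))"
      unfolding sets_density by (rule sets_PiM_cong) simp_all
    fix A :: "'a \<Rightarrow> complex set" assume A: "\<And>i. i \<in> I \<Longrightarrow> A i \<in> sets CN01"
    have "emeasure (density (PiM I (\<lambda>_. lborel)) (\<lambda>x. \<Prod>i\<in>I. ennreal (exp (- (cmod (x i))\<^sup>2) / pi))) (Pi\<^sub>E I A) =
      (\<integral>\<^sup>+x. (\<Prod>i\<in>I. ennreal (exp (- (cmod (x i))\<^sup>2) / pi)) * indicator (Pi\<^sub>E I A) x \<partial>PiM I (\<lambda>_. lborel))"
      using A by (intro emeasure_density sets_PiM_I_finite) auto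
    also have "\<dots> = (\<integral>\<^sup>+x. (\<Prod>i\<in>I. ennreal (exp (- (cmod (x i))\<^sup>2) / pi) * indicator (A i) (x i)) \<partial>PiM I (\<lambda>_. lborel))"
    proof (rule nn_integral_cong)
      fix x :: "'a \<Rightarrow> complex" assume "x \<in> space (PiM I (\<lambda>_. lborel))"
      \<comment> \<open>Extensionality reduces membership in the box to the coordinate conditions,
        so its indicator is a product.\<close>
      then have "x \<in> extensional I" by (simp add: space_PiM PiE_iff)
      then have "(\<Prod>i\<in>I. indicator (A i) (x i)) = (indicator (Pi\<^sub>E I A) x :: ennreal)"
        by (cases "\<forall>i\<in>I. x i \<in> A i") (auto simp: PiE_iff prod_zero_iff indicator_def)
      then show "(\<Prod>i\<in>I. ennreal (exp (- (cmod (x i))\<^sup>2) / pi)) * indicator (Pi\<^sub>E I A) x =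
        (\<Prod>i\<in>I. ennreal (exp (- (cmod (x i))\<^sup>2) / pi) * indicator (A i) (x i))"
        by (simp add: prod.distrib)
    qed
    also have "\<dots> = (\<Prod>i\<in>I. \<integral>\<^sup>+z. ennreal (exp (- (cmod z)\<^sup>2) / pi) * indicator (A i) z \<partial>lborel)"
      using A by (intro L.product_nn_integral_prod) auto
    also have "\<dots> = (\<Prod>i\<in>I. emeasure CN01 (A i))"
      using A unfolding CN01_def by (intro prod.cong refl emeasure_density[symmetric]) auto
    finally show "emeasure (density (PiM I (\<lambda>_. lborel)) (\<lambda>x. \<Prod>i\<in>I. ennreal (exp (- (cmod (x i))\<^sup>2) / pi))) (Pi\<^sub>E I A) =
      (\<Prod>i\<in>I. emeasure CN01 (A i))" .
  qed simp
qed

text \<open>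
  For a real \<open>c \<ge> 0\<close> with \<open>c\<^sup>2 + \<parallel>s\<parallel>\<^sup>2 = 1\<close> this is the unitary map with last row \<open>(s, c)\<close> and
  last column \<open>(- s\<^sup>*, c)\<close> (the last coordinate having index \<open>r\<close>). It is the product
  of three shears: add \<open>\<kappa> s \<cdot> x\<close> to the last coordinate, subtract \<open>s\<^sup>*\<close> times the last coordinate
  from the others, and repeat the first shear, where \<open>\<kappa> = 1 / (1 + c)\<close>.
\<close>
definition reflect :: "nat \<Rightarrow> (nat \<Rightarrow> complex) \<Rightarrow> real \<Rightarrow> (nat \<Rightarrow> complex) \<Rightarrow> nat \<Rightarrow> complex" where
  "reflect r s c x i =
    (if i < r then x i - cnj (s i) * (x r + of_real (1 / (1 + c)) * (\<Sum>k<r. s k * x k))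
     else of_real c * x r + (\<Sum>k<r. s k * x k))"

lemma reflect_inner:
  assumes c: "0 \<le> c" "c\<^sup>2 + (\<Sum>k<r. (cmod (s k))\<^sup>2) = 1"
  shows "(\<Sum>i<Suc r. cnj (reflect r s c x i) * reflect r s c y i) = (\<Sum>i<Suc r. cnj (x i) * y i)"
proof -
  define p where "p = (\<Sum>k<r. s k * x k)"
  define q where "q = (\<Sum>k<r. s k * y k)"
  define K where "K = complex_of_real (1 / (1 + c))"
  define C where "C = complex_of_real c"
  have K: "K * (1 + C) = 1"
  proof -
    have "1 / (1 + c) * (1 + c) = 1" using c by simp
    then have "complex_of_real (1 / (1 + c) * (1 + c)) = of_real 1" by (rule arg_cong)
    then show ?thesis unfolding K_def C_def of_real_mult of_real_add by simp
  qed
  have cnjs: "cnj K = K" "cnj C = C" by (simp_all add: K_def C_def)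
  define a where "a = x r + K * p"
  define b where "b = y r + K * q"
  have "(\<Sum>k<r. s k * cnj (s k)) = complex_of_real (\<Sum>k<r. (cmod (s k))\<^sup>2)"
    by (simp only: of_real_sum complex_norm_square)
  also have "\<dots> = complex_of_real (1 - c\<^sup>2)" by (rule arg_cong[where f = of_real]) (use c(2) in linarith)
  finally have ss: "(\<Sum>k<r. s k * cnj (s k)) = 1 - C * C" by (simp add: C_def power2_eq_square)
  have "(\<Sum>i<r. cnj (reflect r s c x i) * reflect r s c y i) =
    (\<Sum>i<r. cnj (x i) * y i - cnj a * (s i * y i) - b * cnj (s i * x i) + cnj a * b * (s i * cnj (s i)))"
    by (intro sum.cong) (auto simp: reflect_def a_def b_def p_def q_def K_def algebra_simps)
  also have "\<dots> = (\<Sum>i<r. cnj (x i) * y i) - cnj a * q - b * cnj p + cnj a * b * (1 - C * C)"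
    unfolding ss[symmetric] p_def q_def cnj_sum sum_distrib_left
    by (simp only: sum.distrib sum_subtractf)
  finally have 1: "(\<Sum>i<r. cnj (reflect r s c x i) * reflect r s c y i) =
    (\<Sum>i<r. cnj (x i) * y i) - cnj a * q - b * cnj p + cnj a * b * (1 - C * C)" .
  have 2: "cnj (reflect r s c x r) * reflect r s c y r = (C * cnj (x r) + cnj p) * (C * y r + q)"
    by (simp add: reflect_def p_def q_def C_def)
  \<comment> \<open>What is left is a polynomial identity in which \<open>X\<close> and
    \<open>P\<close> stand for the conjugates of \<open>x r\<close> and \<open>p\<close>. It rests
    on K (1 + C) = 1 alone, which also gives K (1 - C^2) = 1 - C.\<close>
  have "- (X + K * P) * q - (Y + K * q) * P + (X + K * P) * (Y + K * q) * (1 - C * C) + (C * X + P) * (C * Y + q) = X * Y"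
    for X Y P
  proof -
    have k2: "K * (1 - C * C) = 1 - C"
    proof -
      have "K * (1 - C * C) = (K * (1 + C)) * (1 - C)" by (simp add: algebra_simps)
      then show ?thesis by (simp add: K)
    qed
    have "(X + K * P) * (Y + K * q) * (1 - C * C) =
      X * Y * (1 - C * C) + (X * q + P * Y) * (K * (1 - C * C)) + P * q * K * (K * (1 - C * C))"
      by (simp add: algebra_simps)
    then have "- (X + K * P) * q - (Y + K * q) * P + (X + K * P) * (Y + K * q) * (1 - C * C) + (C * X + P) * (C * Y + q) =
      X * Y + P * q * (1 - K * (1 + C))"
      unfolding k2 by (simp add: algebra_simps)
    then show ?thesis by (simp add: K)
  qed
  from this[of "cnj (x r)" "cnj p" "y r"] show ?thesis
    unfolding sum.lessThan_Suc 1 2 by (simp add: a_def b_def cnjs algebra_simps)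
qed

lemma reflect_norm:
  assumes "0 \<le> c" "c\<^sup>2 + (\<Sum>k<r. (cmod (s k))\<^sup>2) = 1"
  shows "(\<Sum>i<Suc r. (cmod (reflect r s c x i))\<^sup>2) = (\<Sum>i<Suc r. (cmod (x i))\<^sup>2)"
proof -
  have "complex_of_real (\<Sum>i<Suc r. (cmod (z i))\<^sup>2) = (\<Sum>i<Suc r. cnj (z i) * z i)" for z
    unfolding of_real_sum by (intro sum.cong refl) (simp only: complex_norm_square mult.commute)
  then show ?thesis using reflect_inner[OF assms, of x x] by (metis of_real_eq_iff)
qed

text \<open>For v nonzero the target is w times the last basis vector, where w has modulus N = |v|
  and the phase of \<open>v r\<close>. This phase makes c = |v r| / N real and nonnegative. With s k
  = cnj (v k / w), the bracket in \<open>reflect\<close> becomes w, since (N^2 - m^2) / (N + m) = N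
  - m, and v i - cnj (s i) w vanishes. For v = 0 the identity map serves.\<close>

lemma ex_reflect_eliminates:
  fixes v :: "nat \<Rightarrow> complex"
  obtains s c where "0 \<le> c" "c\<^sup>2 + (\<Sum>k<r. (cmod (s k))\<^sup>2) = 1" "\<And>i. i < r \<Longrightarrow> reflect r s c v i = 0"
proof (cases "(\<Sum>i<Suc r. (cmod (v i))\<^sup>2) = 0")
  case True
  then have "\<forall>i\<in>{..<Suc r}. (cmod (v i))\<^sup>2 = 0" by (subst (asm) sum_nonneg_eq_0_iff) auto
  then have "reflect r (\<lambda>_. 0) 1 v i = 0" if "i < r" for i using that by (auto simp: reflect_def)
  then show ?thesis by (intro that[of 1 "\<lambda>_. 0"]) auto
next
  case False
  define N where "N = sqrt (\<Sum>i<Suc r. (cmod (v i))\<^sup>2)"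
  define m where "m = cmod (v r)"
  have "0 \<le> (\<Sum>i<Suc r. (cmod (v i))\<^sup>2)" by (intro sum_nonneg) auto
  then have N: "0 < N" "N\<^sup>2 = (\<Sum>i<r. (cmod (v i))\<^sup>2) + m\<^sup>2"
    using False by (auto simp: N_def m_def)
  have m: "0 \<le> m" by (simp add: m_def)
  \<comment> \<open>If \<open>v r\<close> is 0, any phase will do; 1 is taken because
    \<open>sgn\<close> would give 0.\<close>
  define u where "u = (if v r = 0 then 1 else sgn (v r))"
  have u: "cmod u = 1" "v r = of_real m * u" by (auto simp: u_def m_def norm_divide sgn_eq)
  have uu: "cnj u * u = 1" using u(1) complex_norm_square[of u] by (simp add: mult.commute)
  have [simp]: "u \<noteq> 0" using u(1) by auto
  define w where "w = of_real N * u"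
  have w: "w \<noteq> 0" "cmod w = N" using N u by (auto simp: w_def norm_mult)
  define s where "s = (\<lambda>k. cnj (v k / w))"
  define c where "c = m / N"
  have norms: "(\<Sum>k<r. (cmod (s k))\<^sup>2) = (N\<^sup>2 - m\<^sup>2) / N\<^sup>2"
    using N(2) by (simp add: s_def norm_divide w power_divide flip: sum_divide_distrib)
  have "(\<Sum>k<r. s k * v k) = (\<Sum>k<r. of_real ((cmod (v k))\<^sup>2)) / cnj w"
    unfolding sum_divide_distrib complex_norm_square s_def by (intro sum.cong) auto
  also have "\<dots> = of_real (N\<^sup>2 - m\<^sup>2) / cnj w" using N(2) by simp
  also have "cnj w = of_real N / u" using uu by (simp add: w_def field_simps)
  finally have p: "(\<Sum>k<r. s k * v k) = of_real ((N\<^sup>2 - m\<^sup>2) / N) * u" by simp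
  have "1 / (1 + c) = N / (N + m)"
    using N(1) m by (simp add: c_def field_simps)
  moreover have "N\<^sup>2 - m\<^sup>2 = (N + m) * (N - m)" by (simp add: power2_eq_square algebra_simps)
  ultimately have "1 / (1 + c) * ((N\<^sup>2 - m\<^sup>2) / N) = N - m"
    using N(1) m by simp
  then have "of_real (1 / (1 + c)) * (\<Sum>k<r. s k * v k) = of_real (N - m) * u"
    unfolding p mult.assoc[symmetric] of_real_mult[symmetric] by simp
  then have "v r + of_real (1 / (1 + c)) * (\<Sum>k<r. s k * v k) = w"
    by (simp add: u(2) w_def algebra_simps)
  then have "reflect r s c v i = 0" if "i < r" for i
    using that w by (simp add: reflect_def s_def)
  moreover have "c\<^sup>2 + (\<Sum>k<r. (cmod (s k))\<^sup>2) = 1"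
    unfolding norms using N(1) by (simp add: c_def power_divide field_simps)
  moreover have "0 \<le> c" using N m by (simp add: c_def)
  ultimately show ?thesis using that[of c s] by blast
qed

text \<open>The restriction to the index set makes the values extensional, hence points of the
  product space.\<close>

definition reflect_cols :: "nat \<Rightarrow> nat \<Rightarrow> (nat \<Rightarrow> complex) \<Rightarrow> real \<Rightarrow> (nat \<times> nat \<Rightarrow> complex) \<Rightarrow> nat \<times> nat \<Rightarrow> complex" where
  "reflect_cols r t s c H = (\<lambda>(i, j)\<in>{..<Suc r} \<times> {..<t}. reflect r s c (\<lambda>k. H (k, j)) i)"

text \<open>The three-shear factorisation is applied to all columns at once: \<open>S\<close> moves
  only the last row and \<open>T\<close> only the others, each by amounts depending on the rows left
  fixed.\<close>

lemma nn_integral_lborel_reflect_cols: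
  fixes r t :: nat and s :: "nat \<Rightarrow> complex" and c :: real
  defines "P \<equiv> PiM ({..<Suc r} \<times> {..<t}) (\<lambda>_. lborel :: complex measure)"
  assumes c: "0 \<le> c" "c\<^sup>2 + (\<Sum>k<r. (cmod (s k))\<^sup>2) = 1"
  shows "reflect_cols r t s c \<in> P \<rightarrow>\<^sub>M P"
    and "f \<in> borel_measurable P \<Longrightarrow> (\<integral>\<^sup>+H. f (reflect_cols r t s c H) \<partial>P) = (\<integral>\<^sup>+H. f H \<partial>P)"
proof -
  define K where "K = complex_of_real (1 / (1 + c))"
  \<comment> \<open>Two orders of the same decomposition, because the shear lemma expects the moved
    block first.\<close>
  have J: "{..<Suc r} \<times> {..<t} = ({r} \<times> {..<t}) \<union> ({..<r} \<times> {..<t})"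
    "{..<Suc r} \<times> {..<t} = ({..<r} \<times> {..<t}) \<union> ({r} \<times> {..<t})"
    by auto
  define g where "g = (\<lambda>H (i::nat, j::nat). K * (\<Sum>k<r. s k * H (k, j)))"
  define h where "h = (\<lambda>H (i::nat, j::nat). - cnj (s i) * H (r, j) :: complex)"
  define S where "S = (\<lambda>H. \<lambda>p\<in>{..<Suc r} \<times> {..<t}. if p \<in> {r} \<times> {..<t} then H p + g H p else H p)"
  define T where "T = (\<lambda>H. \<lambda>p\<in>{..<Suc r} \<times> {..<t}. if p \<in> {..<r} \<times> {..<t} then H p + h H p else H p)"
  have comp: "(\<lambda>H. H (i, j)) \<in> borel_measurable P" if "i \<le> r" "j < t" for i j
    using that unfolding P_def by (auto intro!: measurable_component_singleton[THEN measurable_compose])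
  have Sm: "S \<in> P \<rightarrow>\<^sub>M P"
    unfolding S_def g_def P_def
    by (rule measurable_restrict) (auto intro!: borel_measurable_add borel_measurable_times borel_measurable_sum comp[unfolded P_def] split: prod.splits)
  have Tm: "T \<in> P \<rightarrow>\<^sub>M P"
    unfolding T_def h_def P_def
    by (rule measurable_restrict) (auto intro!: borel_measurable_add borel_measurable_times comp[unfolded P_def] split: prod.splits)
  have S: "(\<integral>\<^sup>+H. f (S H) \<partial>P) = (\<integral>\<^sup>+H. f H \<partial>P)" if "f \<in> borel_measurable P" for f
    using that Sm unfolding S_def P_def J(1)
    by (intro nn_integral_PiM_lborel_shear) (auto simp: g_def)
  have T: "(\<integral>\<^sup>+H. f (T H) \<partial>P) = (\<integral>\<^sup>+H. f H \<partial>P)" if "f \<in> borel_measurable P" for f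
    using that Tm unfolding T_def P_def J(2)
    by (intro nn_integral_PiM_lborel_shear) (auto simp: h_def)
  \<comment> \<open>The coefficient with which the sheared last entry survives the second shear and
    the repeated first one: K (1 - c^2) = 1 - c.\<close>
  have K: "1 - K * (\<Sum>k<r. s k * cnj (s k)) = of_real c"
  proof -
    have "(\<Sum>k<r. s k * cnj (s k)) = complex_of_real (\<Sum>k<r. (cmod (s k))\<^sup>2)"
      by (simp only: of_real_sum complex_norm_square)
    also have "\<dots> = complex_of_real (1 - c\<^sup>2)" by (rule arg_cong[where f = of_real]) (use c(2) in linarith)
    finally have "1 - K * (\<Sum>k<r. s k * cnj (s k)) = of_real (1 - 1 / (1 + c) * (1 - c\<^sup>2))"
      unfolding K_def by simp
    also have "1 - 1 / (1 + c) * (1 - c\<^sup>2) = c"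
      using c(1) by (simp add: field_simps power2_eq_square)
    finally show ?thesis .
  qed
  have eq: "reflect_cols r t s c H = S (T (S H))" for H
  proof
    fix p :: "nat \<times> nat"
    obtain i j where p: "p = (i, j)" by fastforce
    show "reflect_cols r t s c H p = S (T (S H)) p"
    proof (cases "i < Suc r \<and> j < t")
      case True
      define q where "q = (\<Sum>k<r. s k * H (k, j))"
      define a where "a = H (r, j) + K * q"
      have SH: "S H (r, j) = a" "k < r \<Longrightarrow> S H (k, j) = H (k, j)" for k
        using True by (auto simp: S_def g_def a_def q_def)
      have TSH: "T (S H) (r, j) = a" "k < r \<Longrightarrow> T (S H) (k, j) = H (k, j) - cnj (s k) * a" for k
        using True by (auto simp: T_def h_def SH)
      show ?thesis
      proof (cases "i < r")
        case True
        then show ?thesis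
          using \<open>i < Suc r \<and> j < t\<close> TSH(2)[of i]
          by (simp add: p reflect_cols_def reflect_def S_def a_def q_def K_def)
      next
        case False
        then have i: "i = r" using True by simp
        have "S (T (S H)) p = a + K * (\<Sum>k<r. s k * (H (k, j) - cnj (s k) * a))"
          using True by (simp add: fun_cong[OF S_def, of "T (S H)"] p i g_def TSH)
        also have "(\<Sum>k<r. s k * (H (k, j) - cnj (s k) * a)) = q - (\<Sum>k<r. s k * cnj (s k)) * a"
          by (simp add: q_def sum_subtractf sum_distrib_right right_diff_distrib mult.assoc)
        also have "a + K * (q - (\<Sum>k<r. s k * cnj (s k)) * a) = (1 - K * (\<Sum>k<r. s k * cnj (s k))) * a + K * q"
          by (simp add: algebra_simps)
        also have "\<dots> = of_real c * H (r, j) + K * (1 + of_real c) * q"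
          unfolding K by (simp add: a_def algebra_simps)
        also have "K * (1 + of_real c) = 1"
        proof -
          have "1 / (1 + c) * (1 + c) = 1" using c by simp
          then have "complex_of_real (1 / (1 + c) * (1 + c)) = of_real 1" by (rule arg_cong)
          then show ?thesis unfolding K_def of_real_mult of_real_add by simp
        qed
        finally show ?thesis using True by (simp add: p i reflect_cols_def reflect_def q_def)
      qed
    qed (auto simp: p reflect_cols_def S_def)
  qed
  have ST: "(\<lambda>H. S (T H)) \<in> P \<rightarrow>\<^sub>M P" using measurable_compose[OF Tm Sm] .
  have STS: "(\<lambda>H. S (T (S H))) \<in> P \<rightarrow>\<^sub>M P" using measurable_compose[OF Sm ST] .
  show "reflect_cols r t s c \<in> P \<rightarrow>\<^sub>M P" using STS by (simp add: eq[abs_def])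
  assume f: "f \<in> borel_measurable P"
  have "(\<integral>\<^sup>+H. f (S (T (S H))) \<partial>P) = (\<integral>\<^sup>+H. f (S (T H)) \<partial>P)"
    by (rule S) (rule measurable_compose[OF ST f])
  also have "\<dots> = (\<integral>\<^sup>+H. f (S H) \<partial>P)" by (rule T) (rule measurable_compose[OF Sm f])
  also have "\<dots> = (\<integral>\<^sup>+H. f H \<partial>P)" by (rule S) (rule f)
  finally show "(\<integral>\<^sup>+H. f (reflect_cols r t s c H) \<partial>P) = (\<integral>\<^sup>+H. f H \<partial>P)" by (simp add: eq)
qed

text \<open>The Gaussian density depends only on the sum of all squared moduli, which is preserved
  column by column; Lebesgue invariance is then applied to the product
  \<open>d H * f H\<close>.\<close>

lemma nn_integral_CN01_reflect_cols:
  fixes r t :: nat and s :: "nat \<Rightarrow> complex" and c :: real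
  defines "P \<equiv> PiM ({..<Suc r} \<times> {..<t}) (\<lambda>_. CN01)"
  assumes c: "0 \<le> c" "c\<^sup>2 + (\<Sum>k<r. (cmod (s k))\<^sup>2) = 1"
    and f: "f \<in> borel_measurable P"
  shows "(\<integral>\<^sup>+H. f (reflect_cols r t s c H) \<partial>P) = (\<integral>\<^sup>+H. f H \<partial>P)"
proof -
  let ?J = "{..<Suc r} \<times> {..<t}"
  let ?L = "PiM ?J (\<lambda>_. lborel :: complex measure)"
  define d where "d = (\<lambda>H. \<Prod>p\<in>?J. ennreal (exp (- (cmod (H p))\<^sup>2) / pi))"
  have P: "P = density ?L d" unfolding P_def d_def by (rule PiM_CN01_eq_density) simp
  have d: "d \<in> borel_measurable ?L" unfolding d_def by measurable
  have f': "f \<in> borel_measurable ?L" using f by (simp add: P)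
  have df: "(\<lambda>H. d H * f H) \<in> borel_measurable ?L" using d f' by measurable
  have inv: "d (reflect_cols r t s c H) = d H" for H
  proof -
    have deq: "d G = ennreal (exp (- (\<Sum>p\<in>?J. (cmod (G p))\<^sup>2)) / pi ^ card ?J)" for G
      unfolding d_def by (subst prod_ennreal) (auto simp: prod_dividef exp_sum simp flip: sum_negf)
    have "(\<Sum>p\<in>?J. (cmod (reflect_cols r t s c H p))\<^sup>2) =
      (\<Sum>j<t. \<Sum>i<Suc r. (cmod (reflect_cols r t s c H (i, j)))\<^sup>2)"
      by (subst sum.swap) (simp only: sum.cartesian_product case_prod_unfold prod.collapse)
    also have "\<dots> = (\<Sum>j<t. \<Sum>i<Suc r. (cmod (reflect r s c (\<lambda>k. H (k, j)) i))\<^sup>2)"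
      by (intro sum.cong refl) (simp add: reflect_cols_def)
    also have "\<dots> = (\<Sum>j<t. \<Sum>i<Suc r. (cmod (H (i, j)))\<^sup>2)"
      by (intro sum.cong refl reflect_norm c)
    also have "\<dots> = (\<Sum>p\<in>?J. (cmod (H p))\<^sup>2)"
      by (subst sum.swap) (simp only: sum.cartesian_product case_prod_unfold prod.collapse)
    finally show ?thesis by (simp only: deq)
  qed
  have R: "reflect_cols r t s c \<in> ?L \<rightarrow>\<^sub>M ?L" by (rule nn_integral_lborel_reflect_cols(1)[OF c])
  have "(\<integral>\<^sup>+H. f (reflect_cols r t s c H) \<partial>P) = (\<integral>\<^sup>+H. d H * f (reflect_cols r t s c H) \<partial>?L)"
    unfolding P by (rule nn_integral_density[OF d measurable_compose[OF R f']])
  also have "\<dots> = (\<integral>\<^sup>+H. d (reflect_cols r t s c H) * f (reflect_cols r t s c H) \<partial>?L)"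
    by (simp add: inv)
  also have "\<dots> = (\<integral>\<^sup>+H. d H * f H \<partial>?L)"
    by (rule nn_integral_lborel_reflect_cols(2)[OF c df])
  also have "\<dots> = (\<integral>\<^sup>+H. f H \<partial>P)" unfolding P by (rule nn_integral_density[OF d f', symmetric])
  finally show ?thesis .
qed

subsection \<open>The law of the Gram determinant\<close>

lemma prob_space_iid_CN_matrices: "prob_space (iid_CN_matrices r t)"
  unfolding iid_CN_matrices_def by (intro prob_space_PiM prob_space_CN01)

text \<open>With the dimensions as parameters, the same \<open>H\<close> can also be read as its
  upper left block, without constructing a submatrix.\<close>

definition gram_det :: "nat \<Rightarrow> nat \<Rightarrow> (nat \<times> nat \<Rightarrow> complex) \<Rightarrow> real" where
  "gram_det r t H = Re (det (mat t t (\<lambda>(j, k). \<Sum>i<r. cnj (H (i, j)) * H (i, k))))"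

lemma mat_adjoint_mult_to_mat:
  "mat_adjoint (to_mat r t H) * to_mat r t H = mat t t (\<lambda>(j, k). \<Sum>i<r. cnj (H (i, j)) * H (i, k))"
  by (rule eq_matI)
    (auto simp: mat_adjoint_def to_mat_def mat_of_rows_def scalar_prod_def lessThan_atLeast0 intro!: sum.cong)

lemma gram_det_cong:
  assumes "\<And>i j. i < r \<Longrightarrow> j < t \<Longrightarrow> H (i, j) = H' (i, j)"
  shows "gram_det r t H = gram_det r t H'"
  unfolding gram_det_def
  by (intro arg_cong[where f = Re] arg_cong[where f = det] eq_matI) (auto simp: assms intro!: sum.cong)

lemma gram_det_reflect:
  assumes "0 \<le> c" "c\<^sup>2 + (\<Sum>k<r. (cmod (s k))\<^sup>2) = 1"
  shows "gram_det (Suc r) t (\<lambda>(i, j). reflect r s c (\<lambda>k. H (k, j)) i) = gram_det (Suc r) t H"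
  unfolding gram_det_def
  by (intro arg_cong[where f = Re] arg_cong[where f = det] eq_matI)
    (auto simp: reflect_inner[OF assms] simp del: sum.lessThan_Suc)

lemma gram_det_last_column:
  assumes H: "\<And>i. i < r \<Longrightarrow> H (i, t) = 0"
  shows "gram_det (Suc r) (Suc t) H = (cmod (H (r, t)))\<^sup>2 * gram_det r t H"
proof -
  define G where "G = mat t t (\<lambda>(j, k). \<Sum>i<r. cnj (H (i, j)) * H (i, k))"
  define x where "x = H (r, t)"
  define R where "R = mat 1 t (\<lambda>(_, j). H (r, j))"
  define R' where "R' = mat t 1 (\<lambda>(j, _). cnj (H (r, j)))"
  define X where "X = mat 1 1 (\<lambda>_. x)"
  define X' where "X' = mat 1 1 (\<lambda>_. cnj x)"
  have carr: "G \<in> carrier_mat t t" "R \<in> carrier_mat 1 t" "R' \<in> carrier_mat t 1"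
    "X \<in> carrier_mat 1 1" "X' \<in> carrier_mat 1 1"
    by (simp_all add: G_def R_def R'_def X_def X'_def)
  \<comment> \<open>The last column being concentrated in row \<open>r\<close>, the Gram matrix is \<open>C\<^sup>* diag(G, 1) C\<close> with triangular \<open>C\<close>.\<close>
  let ?C = "four_block_mat (1\<^sub>m t) (0\<^sub>m t 1) R X"
  let ?D = "four_block_mat G (0\<^sub>m t 1) (0\<^sub>m 1 t) (1\<^sub>m 1)"
  let ?E = "four_block_mat (1\<^sub>m t) R' (0\<^sub>m 1 t) X'"
  have "?D * ?C = four_block_mat G (0\<^sub>m t 1) R X"
    using carr by (subst mult_four_block_mat[of _ t t _ 1 _ 1 _ _ t _ 1]) auto
  then have "?E * (?D * ?C) = four_block_mat (G + R' * R) (R' * X) (X' * R) (X' * X)"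
    using carr by (simp, subst mult_four_block_mat[of _ t t _ 1 _ 1 _ _ t _ 1]) auto
  also have "\<dots> = mat (Suc t) (Suc t) (\<lambda>(j, k). \<Sum>i<Suc r. cnj (H (i, j)) * H (i, k))"
  proof (rule eq_matI, goal_cases)
    case (1 j k)
    then consider "j < t" "k < t" | "j < t" "k = t" | "j = t" "k < t" | "j = t" "k = t"
      by (auto simp: less_Suc_eq)
    then show ?case
      by cases (auto simp: four_block_mat_def Let_def G_def R_def R'_def X_def X'_def x_def scalar_prod_def H)
  qed (simp_all add: G_def R_def R'_def X_def X'_def)
  finally have eq: "mat (Suc t) (Suc t) (\<lambda>(j, k). \<Sum>i<Suc r. cnj (H (i, j)) * H (i, k)) = ?E * (?D * ?C)" ..
  have "det ?C = x"
    using carr by (subst det_four_block_mat_upper_right_zero[of _ t _ 1]) (auto simp: det_single X_def)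
  moreover have "det ?D = det G"
    using carr by (subst det_four_block_mat_upper_right_zero[of _ t _ 1]) auto
  moreover have "det ?E = cnj x"
    using carr by (subst det_four_block_mat_lower_left_zero[of _ t _ 1]) (auto simp: det_single X'_def)
  ultimately have "det ?E * (det ?D * det ?C) = cnj x * (det G * x)" by simp
  moreover have dims: "?C \<in> carrier_mat (t + 1) (t + 1)" "?D \<in> carrier_mat (t + 1) (t + 1)"
    "?E \<in> carrier_mat (t + 1) (t + 1)"
    using carr by auto
  have "det (?E * (?D * ?C)) = det ?E * (det ?D * det ?C)"
    using det_mult[OF dims(3) mult_carrier_mat[OF dims(2,1)]] det_mult[OF dims(2,1)] by simp
  ultimately have "det (?E * (?D * ?C)) = cnj x * (det G * x)" by simp
  also have "\<dots> = of_real ((cmod x)\<^sup>2) * det G"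
    unfolding complex_norm_square by simp
  finally show ?thesis
    unfolding gram_det_def eq by (simp add: G_def x_def)
qed

text \<open>By the Leibniz formula this is the real part of a polynomial in the entries and their
  conjugates. The index set \<open>J\<close> may be larger than the block, as happens when an extra
  row is still present.\<close>

lemma measurable_gram_det:
  assumes "{..<r} \<times> {..<t} \<subseteq> J"
  shows "gram_det r t \<in> borel_measurable (PiM J (\<lambda>_. CN01))"
proof -
  have [measurable]: "(\<lambda>z. cnj z) \<in> borel_measurable borel" "Re \<in> borel_measurable borel"
    by (intro borel_measurable_continuous_onI continuous_intros)+
  have comp: "(\<lambda>H. H (i, j)) \<in> borel_measurable (PiM J (\<lambda>_. CN01))" if "i < r" "j < t" for i j
    using measurable_component_singleton[of "(i, j)" J "\<lambda>_. CN01"] that assms by auto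
  then have compc: "(\<lambda>H. cnj (H (i, j))) \<in> borel_measurable (PiM J (\<lambda>_. CN01))" if "i < r" "j < t" for i j
    using that by measurable
  have "gram_det r t = (\<lambda>H. Re (\<Sum>p | p permutes {0..<t}. signof p *
      (\<Prod>i = 0..<t. \<Sum>k<r. cnj (H (k, i)) * H (k, p i))))"
    unfolding gram_det_def
    by (subst det_def'[of _ t])
      (auto intro!: ext sum.cong prod.cong dest: permutes_in_image)
  also have "\<dots> \<in> borel_measurable (PiM J (\<lambda>_. CN01))"
    by (intro measurable_compose[OF _ \<open>Re \<in> borel_measurable borel\<close>] borel_measurable_sum borel_measurable_times
        borel_measurable_prod borel_measurable_const compc comp) (auto dest: permutes_in_image)
  finally show ?thesis .
qed

text \<open>A sum of \<open>card I\<close> independent standard exponentials; the index of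
  \<open>erlang_density\<close> is one less than the Gamma parameter.\<close>

lemma distr_norm_squared_CN01:
  assumes fin: "finite I" and ne: "I \<noteq> {}"
  shows "distr (PiM I (\<lambda>_. CN01)) lborel (\<lambda>v. \<Sum>p\<in>I. (cmod (v p))\<^sup>2) =
    density lborel (erlang_density (card I - 1) 1)"
proof -
  let ?P = "PiM I (\<lambda>_. CN01)"
  interpret prob_space ?P by (intro prob_space_PiM prob_space_CN01)
  have comp: "(\<lambda>v. v p) \<in> ?P \<rightarrow>\<^sub>M CN01" if "p \<in> I" for p
    using that by (rule measurable_component_singleton)
  have compD: "distr ?P CN01 (\<lambda>v. v p) = CN01" if "p \<in> I" for p
    using that by (intro distr_PiM_component prob_space_CN01)
  have "indep_vars (\<lambda>_. CN01) (\<lambda>p v. v p) I"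
  proof (subst indep_vars_iff_distr_eq_PiM'[OF ne])
    have "distr ?P ?P (\<lambda>v. \<lambda>p\<in>I. v p) = distr ?P ?P (\<lambda>v. v)"
      by (intro distr_cong) (auto simp: space_PiM)
    also have "\<dots> = PiM I (\<lambda>p. distr ?P CN01 (\<lambda>v. v p))"
      by (simp add: compD cong: PiM_cong)
    finally show "distr ?P ?P (\<lambda>v. \<lambda>p\<in>I. v p) = PiM I (\<lambda>p. distr ?P CN01 (\<lambda>v. v p))" .
  qed (rule comp)
  then have "indep_vars (\<lambda>_. borel) (\<lambda>p v. (cmod (v p))\<^sup>2) I"
    by (rule indep_vars_compose2) measurable
  moreover have "distributed ?P lborel (\<lambda>v. (cmod (v p))\<^sup>2) (exponential_density 1)" if "p \<in> I" for p
  proof -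
    have "distr ?P lborel (\<lambda>v. (cmod (v p))\<^sup>2) = distr (distr ?P CN01 (\<lambda>v. v p)) lborel (\<lambda>z. (cmod z)\<^sup>2)"
      using comp[OF that] by (subst distr_distr) (auto simp: comp_def)
    also have "\<dots> = density lborel (exponential_density 1)"
      using distributed_CN01_norm_squared by (simp add: compD that distributed_def)
    finally show ?thesis
      using measurable_compose[OF comp[OF that], of "\<lambda>z. (cmod z)\<^sup>2" borel] by (auto simp: distributed_def)
  qed
  ultimately have "distributed ?P lborel (\<lambda>v. \<Sum>p\<in>I. (cmod (v p))\<^sup>2) (erlang_density (card I - 1) 1)"
    by (intro exponential_distributed_sum fin ne) auto
  then show ?thesis by (simp add: distributed_def)
qed

text \<open>The conditional law given the last column. The unitary map depends only on
  \<open>v\<close>, so it is constant while \<open>K\<close> is integrated and can be removed by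
  invariance.\<close>

lemma nn_integral_gram_det_fixed_column:
  fixes v :: "nat \<times> nat \<Rightarrow> complex"
  assumes f: "f \<in> borel_measurable borel"
  shows "(\<integral>\<^sup>+K. f (gram_det (Suc r) (Suc t) (merge ({..<Suc r} \<times> {t}) ({..<Suc r} \<times> {..<t}) (v, K)))
      \<partial>PiM ({..<Suc r} \<times> {..<t}) (\<lambda>_. CN01)) =
    (\<integral>\<^sup>+K. f ((\<Sum>p\<in>{..<Suc r} \<times> {t}. (cmod (v p))\<^sup>2) * gram_det r t K) \<partial>iid_CN_matrices r t)"
proof -
  let ?C = "{..<Suc r} \<times> {t}" and ?B = "{..<Suc r} \<times> {..<t}" and ?Q = "{..<r} \<times> {..<t}"
  define n where "n = (\<Sum>p\<in>?C. (cmod (v p))\<^sup>2)"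
  obtain s c where c: "0 \<le> c" "c\<^sup>2 + (\<Sum>k<r. (cmod (s k))\<^sup>2) = 1"
    and elim: "\<And>i. i < r \<Longrightarrow> reflect r s c (\<lambda>k. v (k, t)) i = 0"
    using ex_reflect_eliminates by blast
  have "n = (\<Sum>i<Suc r. (cmod (v (i, t)))\<^sup>2)"
    unfolding n_def by (rule sum.reindex_bij_witness[of _ "\<lambda>i. (i, t)" fst]) auto
  also have "\<dots> = (cmod (reflect r s c (\<lambda>k. v (k, t)) r))\<^sup>2"
    by (subst reflect_norm[OF c, symmetric]) (simp add: elim)
  finally have n: "(cmod (reflect r s c (\<lambda>k. v (k, t)) r))\<^sup>2 = n" ..
  have reflect_cong: "reflect r s c x i = reflect r s c y i" if "\<And>k. k \<le> r \<Longrightarrow> x k = y k" "i \<le> r" for x y i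
    using that by (simp add: reflect_def)
  define F where "F = (\<lambda>K. f (n * gram_det r t K))"
  have Fm: "F \<in> borel_measurable (PiM S (\<lambda>_. CN01))" if "?Q \<subseteq> S" for S
    unfolding F_def by (intro measurable_compose[OF _ f] borel_measurable_times borel_measurable_const measurable_gram_det that)
  have "f (gram_det (Suc r) (Suc t) (merge ?C ?B (v, K))) = F (reflect_cols r t s c K)" for K
  proof -
    define H where "H = (\<lambda>(i, j). reflect r s c (\<lambda>k. merge ?C ?B (v, K) (k, j)) i)"
    have H_last: "H (i, t) = reflect r s c (\<lambda>k. v (k, t)) i" if "i \<le> r" for i
      unfolding H_def prod.case by (rule reflect_cong) (use that in \<open>auto simp: merge_def\<close>)
    have H: "H (i, j) = reflect_cols r t s c K (i, j)" if "i \<le> r" "j < t" for i j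
      using that unfolding H_def prod.case
      by (subst reflect_cong[where y = "\<lambda>k. K (k, j)"]) (auto simp: merge_def reflect_cols_def)
    have "gram_det (Suc r) (Suc t) (merge ?C ?B (v, K)) = gram_det (Suc r) (Suc t) H"
      unfolding H_def by (rule gram_det_reflect[OF c, symmetric])
    also have "\<dots> = n * gram_det r t H"
      by (subst gram_det_last_column) (simp_all add: H_last elim n)
    also have "gram_det r t H = gram_det r t (reflect_cols r t s c K)"
      by (rule gram_det_cong) (simp add: H)
    finally show ?thesis by (simp add: F_def)
  qed
  then have "(\<integral>\<^sup>+K. f (gram_det (Suc r) (Suc t) (merge ?C ?B (v, K))) \<partial>PiM ?B (\<lambda>_. CN01)) =
    (\<integral>\<^sup>+K. F (reflect_cols r t s c K) \<partial>PiM ?B (\<lambda>_. CN01))" by simp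
  also have "\<dots> = (\<integral>\<^sup>+K. F K \<partial>PiM ?B (\<lambda>_. CN01))"
    by (rule nn_integral_CN01_reflect_cols[OF c Fm]) auto
  \<comment> \<open>\<open>gram_det r t\<close> does not see row \<open>r\<close>, which is
    therefore integrated out.\<close>
  also have "\<dots> = (\<integral>\<^sup>+K. F (\<lambda>p\<in>?Q. K p) \<partial>PiM ?B (\<lambda>_. CN01))"
    unfolding F_def by (intro nn_integral_cong arg_cong[where f = f] arg_cong2[where f = times] refl gram_det_cong) auto
  also have "\<dots> = (\<integral>\<^sup>+K. F K \<partial>distr (PiM ?B (\<lambda>_. CN01)) (PiM ?Q (\<lambda>_. CN01)) (\<lambda>K. \<lambda>p\<in>?Q. K p))"
    by (rule nn_integral_distr[symmetric])
      (intro measurable_restrict measurable_component_singleton, auto intro: Fm)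
  also have "distr (PiM ?B (\<lambda>_. CN01)) (PiM ?Q (\<lambda>_. CN01)) (\<lambda>K. \<lambda>p\<in>?Q. K p) = PiM ?Q (\<lambda>_. CN01)"
    by (rule distr_PiM_reindex[where f = "\<lambda>p. p"]) (auto simp: prob_space_CN01)
  finally show ?thesis by (simp add: F_def n_def iid_CN_matrices_def)
qed

text \<open>The inner integral depends on the last column only through its squared norm, a Gamma
  variable with parameter r + 1. This yields a product of independent variables.\<close>

lemma distr_gram_det_Suc:
  "distr (iid_CN_matrices (Suc r) (Suc t)) borel (gram_det (Suc r) (Suc t)) =
    distr (density lborel (erlang_density r 1) \<Otimes>\<^sub>M distr (iid_CN_matrices r t) borel (gram_det r t))
      borel (\<lambda>(x, y). x * y)" (is "?L = distr (?E \<Otimes>\<^sub>M ?D) borel _")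
proof (rule measure_eqI)
  fix A assume "A \<in> sets ?L"
  then have A: "A \<in> sets borel" by simp
  let ?C = "{..<Suc r} \<times> {t}" and ?B = "{..<Suc r} \<times> {..<t}"
  let ?f = "indicator A :: real \<Rightarrow> ennreal"
  let ?n = "\<lambda>v. \<Sum>p\<in>?C. (cmod (v p))\<^sup>2"
  have f: "?f \<in> borel_measurable borel" using A by simp
  interpret CN: product_sigma_finite "\<lambda>_::nat \<times> nat. CN01"
    by (simp add: product_sigma_finite_def prob_space_imp_sigma_finite prob_space_CN01)
  have gm: "gram_det i j \<in> borel_measurable (iid_CN_matrices i j)" for i j
    unfolding iid_CN_matrices_def by (rule measurable_gram_det) simp
  interpret D: prob_space ?D by (intro prob_space.prob_space_distr prob_space_iid_CN_matrices gm)
  have J: "{..<Suc r} \<times> {..<Suc t} = ?C \<union> ?B" by (auto simp: less_Suc_eq)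
  have "emeasure ?L A = (\<integral>\<^sup>+x. ?f x \<partial>?L)" using A by simp
  also have "\<dots> = (\<integral>\<^sup>+H. ?f (gram_det (Suc r) (Suc t) H) \<partial>iid_CN_matrices (Suc r) (Suc t))"
    by (intro nn_integral_distr gm) (use f in simp)
  also have "\<dots> = (\<integral>\<^sup>+v. \<integral>\<^sup>+K. ?f (gram_det (Suc r) (Suc t) (merge ?C ?B (v, K)))
      \<partial>PiM ?B (\<lambda>_. CN01) \<partial>PiM ?C (\<lambda>_. CN01))"
    unfolding iid_CN_matrices_def J
    by (rule CN.product_nn_integral_fold)
      (use measurable_compose[OF gm f, of "Suc r" "Suc t"] in \<open>auto simp: iid_CN_matrices_def J\<close>)
  also have "\<dots> = (\<integral>\<^sup>+v. \<integral>\<^sup>+K. ?f (?n v * gram_det r t K) \<partial>iid_CN_matrices r t \<partial>PiM ?C (\<lambda>_. CN01))"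
    unfolding nn_integral_gram_det_fixed_column[OF f] ..
  also have "\<dots> = (\<integral>\<^sup>+v. \<integral>\<^sup>+y. ?f (?n v * y) \<partial>?D \<partial>PiM ?C (\<lambda>_. CN01))"
    using gm A by (intro nn_integral_cong) (subst nn_integral_distr; simp)
  also have "\<dots> = (\<integral>\<^sup>+x. \<integral>\<^sup>+y. ?f (x * y) \<partial>?D \<partial>distr (PiM ?C (\<lambda>_. CN01)) lborel ?n)"
  proof (rule nn_integral_distr[symmetric])
    show "?n \<in> PiM ?C (\<lambda>_. CN01) \<rightarrow>\<^sub>M lborel" by measurable
    have "(\<lambda>x. \<integral>\<^sup>+y. ?f (x * y) \<partial>?D) \<in> borel_measurable lborel" using A by measurable
    then show "(\<lambda>x. \<integral>\<^sup>+y. ?f (x * y) \<partial>?D) \<in> borel_measurable (distr (PiM ?C (\<lambda>_. CN01)) lborel ?n)"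
      by simp
  qed
  also have "distr (PiM ?C (\<lambda>_. CN01)) lborel ?n = ?E"
    by (subst distr_norm_squared_CN01) (auto simp: card_cartesian_product)
  also have "(\<integral>\<^sup>+x. \<integral>\<^sup>+y. ?f (x * y) \<partial>?D \<partial>?E) = (\<integral>\<^sup>+p. ?f (fst p * snd p) \<partial>(?E \<Otimes>\<^sub>M ?D))"
    using A by (subst D.nn_integral_fst[symmetric]) simp_all
  also have "\<dots> = (\<integral>\<^sup>+x. ?f x \<partial>distr (?E \<Otimes>\<^sub>M ?D) borel (\<lambda>(x, y). x * y))"
    using f by (subst nn_integral_distr) (simp_all add: split_beta)
  also have "\<dots> = emeasure (distr (?E \<Otimes>\<^sub>M ?D) borel (\<lambda>(x, y). x * y)) A"
    using A by simp
  finally show "emeasure ?L A = emeasure (distr (?E \<Otimes>\<^sub>M ?D) borel (\<lambda>(x, y). x * y)) A" .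
qed simp

text \<open>Each step removes one column and one row, so \<open>r\<close> has to vary in the
  induction and the successive Gamma parameters decrease by one. In the base case the empty
  determinant is 1, whose logarithm is 0.\<close>

lemma log_moments_gram_det:
  assumes "t \<le> r"
  shows "log_moments (distr (iid_CN_matrices r t) borel (gram_det r t))
    (\<Sum>j<t. Digamma (real (r - j))) (\<Sum>j<t. Polygamma 1 (real (r - j)))"
  using assms
proof (induction t arbitrary: r)
  case 0
  interpret prob_space "iid_CN_matrices r 0" by (rule prob_space_iid_CN_matrices)
  have "gram_det r 0 = (\<lambda>_. 1)" by (rule ext) (simp add: gram_det_def det_dim_zero[of _])
  then have "distr (iid_CN_matrices r 0) borel (gram_det r 0) = return borel 1"
    by (simp add: distr_const)
  then show ?case
    by (simp add: log_moments_def prob_space_return AE_return integral_return integrable_iff_bounded nn_integral_return)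
next
  case (Suc t)
  then obtain q where r: "r = Suc q" "t \<le> q" by (cases r) auto
  show ?case
    using log_moments_mult[OF log_moments_erlang[of q] Suc.IH[OF r(2)]]
    unfolding r(1) distr_gram_det_Suc sum.lessThan_Suc_shift by (simp add: add.commute)
qed

section \<open>Trigamma values at integers and the final evaluation of the sums\<close>

lemma Polygamma_one_of_nat:
  "Polygamma 1 (real (Suc n)) = pi\<^sup>2 / 6 - (\<Sum>k=1..n. 1 / (real k)\<^sup>2)"
proof (induction n)
  case 0
  \<comment> \<open>At argument 1 the series is the Basel sum; the recurrence then removes one term
    per step.\<close>
  have "(\<Sum>k. 1 / (real k + 1)\<^sup>2) = pi\<^sup>2 / 6"
    using inverse_squares_sums by (simp add: sums_iff add.commute)
  then show ?case by (simp add: Polygamma_def power2_eq_square inverse_eq_divide add.commute)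
next
  case (Suc n)
  have "Polygamma 1 (real (Suc (Suc n))) = Polygamma 1 (real (Suc n) + 1)" by (simp add: add.commute)
  also have "\<dots> = Polygamma 1 (real (Suc n)) - 1 / (real (Suc n))\<^sup>2"
    by (subst Polygamma_plus1) (simp_all add: power2_eq_square)
  finally show ?case using Suc.IH by (simp del: of_nat_Suc)
qed

text \<open>Counting occurrences: f p lies in all t inner sums if p <= r - t, and in the r - p sums
  with j < r - p otherwise.\<close>

lemma sum_partial_sums:
  fixes f :: "nat \<Rightarrow> real"
  assumes "t \<le> r"
  shows "(\<Sum>j<t. \<Sum>p=1..r - j - 1. f p) =
    real t * (\<Sum>p=1..r - t. f p) + (\<Sum>p=r - t + 1..r - 1. (real r - real p) * f p)"
  using assms
proof (induction t)
  case (Suc t)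
  define n where "n = r - Suc t"
  have n: "r - t = Suc n" "r - Suc t = n" "r - t - 1 = n" "real r - real (Suc n) = real t"
    using Suc.prems by (auto simp: n_def)
  \<comment> \<open>The term with index r - t passes from the first sum to the second, where its
    coefficient r - p equals t. For t = 0 this index exceeds r - 1, but the coefficient is
    0.\<close>
  have "real t * f (Suc n) + (\<Sum>p=Suc n + 1..r - 1. (real r - real p) * f p) =
    (\<Sum>p=n + 1..r - 1. (real r - real p) * f p)"
  proof (cases "t = 0")
    case False
    then have "Suc n \<le> r - 1" using Suc.prems by (simp add: n_def)
    then show ?thesis using n(4) by (simp add: sum.atLeast_Suc_atMost)
  qed (use n Suc.prems in auto)
  then show ?case using Suc by (simp add: n algebra_simps)
qed simp

theorem theorem5p4:
  fixes r t :: nat and \<sigma>2 :: real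
  assumes "1 \<le> t" and "t \<le> r" and "\<sigma>2 > 0"
  defines "M \<equiv> iid_CN_matrices r t"
  defines "L \<equiv> (\<lambda>H. ln (Re (det (mat_adjoint (to_mat r t H) * to_mat r t H))))"
  defines "\<delta> \<equiv> (\<lambda>H. ln (Re (det (smult_mat (complex_of_real (1 / (pi * exp 1 * \<sigma>2)))
                   (mat_adjoint (to_mat r t H) * to_mat r t H)))))"
  shows "integrable M \<delta> \<and> integrable M (\<lambda>H. (L H)\<^sup>2) \<and>
    (\<integral>H. \<delta> H \<partial>M) = - euler_mascheroni * real t + 1 - real t
        + real t * (\<Sum>p=1..r-t. 1 / real p) + real r * (\<Sum>p=r-t+1..r-1. 1 / real p)
        - real t * ln (pi * exp 1 * \<sigma>2) \<and>
    real t + prob_space.variance M L = real t + pi\<^sup>2 * real t / 6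
        - real t * (\<Sum>p=1..r-t. 1 / (real p)\<^sup>2)
        - (\<Sum>p=r-t+1..r-1. (real r - real p) / (real p)\<^sup>2)"
proof -
  interpret M: prob_space M unfolding M_def by (rule prob_space_iid_CN_matrices)
  have [measurable]: "gram_det r t \<in> borel_measurable M"
    unfolding M_def iid_CN_matrices_def by (rule measurable_gram_det) simp
  define m where "m = (\<Sum>j<t. Digamma (real (r - j)))"
  define v where "v = (\<Sum>j<t. Polygamma 1 (real (r - j)))"
  define a where "a = 1 / (pi * exp 1 * \<sigma>2)"
  have a: "0 < a" using assms by (simp add: a_def)
  have L: "L = (\<lambda>H. ln (gram_det r t H))"
    by (simp add: L_def gram_det_def mat_adjoint_mult_to_mat)
  \<comment> \<open>Scaling a t x t matrix by \<open>a\<close> multiplies its determinant by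
    \<open>a ^ t\<close>.\<close>
  have \<delta>: "\<delta> H = ln (a ^ t * gram_det r t H)" for H
    unfolding \<delta>_def a_def[symmetric] mat_adjoint_mult_to_mat gram_det_def
    by (simp flip: of_real_power)
  have "log_moments (distr M borel (gram_det r t)) m v"
    unfolding M_def m_def v_def using assms by (intro log_moments_gram_det) simp
  then have pos: "AE H in M. 0 < gram_det r t H" and intL: "integrable M L"
    and intL2: "integrable M (\<lambda>H. (L H)\<^sup>2)"
    and EL: "(\<integral>H. L H \<partial>M) = m" and EL2: "(\<integral>H. (L H)\<^sup>2 \<partial>M) = v + m\<^sup>2"
    by (auto simp: log_moments_def L AE_distr_iff integrable_distr_eq integral_distr)
  have h\<delta>: "has_bochner_integral M \<delta> (real t * ln a + m)"
  proof (rule has_bochner_integral_cong_AE[THEN iffD2])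
    show "AE H in M. \<delta> H = real t * ln a + L H"
      using pos by eventually_elim (use a in \<open>simp add: \<delta> L ln_mult ln_realpow\<close>)
    show "has_bochner_integral M (\<lambda>H. real t * ln a + L H) (real t * ln a + m)"
      using intL EL by (simp add: has_bochner_integral_iff M.prob_space)
  qed (simp_all add: \<delta>[abs_def] L)
  \<comment> \<open>For j < t <= r the truncated subtraction is harmless and r - j is a successor,
    the form in which the digamma and trigamma values are available.\<close>
  have pred: "real (r - j) = real (Suc (r - j - 1))" if "j < t" for j
    using that assms by simp
  have "m = (\<Sum>j<t. (\<Sum>p=1..r - j - 1. 1 / real p) - euler_mascheroni)"
    unfolding m_def by (intro sum.cong refl) (simp only: pred lessThan_iff Digamma_of_nat harm_def inverse_eq_divide)
  also have "\<dots> = real t * (\<Sum>p=1..r - t. 1 / real p) + (\<Sum>p=r - t + 1..r - 1. (real r - real p) * (1 / real p))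
      - euler_mascheroni * real t"
    using sum_partial_sums[OF assms(2), of "\<lambda>p. 1 / real p"] by (simp add: sum_subtractf)
  also have "(\<Sum>p=r - t + 1..r - 1. (real r - real p) * (1 / real p)) =
      (\<Sum>p=r - t + 1..r - 1. real r * (1 / real p) - 1)"
    by (intro sum.cong) (auto simp: field_simps)
  \<comment> \<open>The index range has t - 1 elements, each contributing -1;
    \<open>1 \<le> t\<close> enters here, and this is the source of the 1 - t in the mean.\<close>
  also have "\<dots> = real r * (\<Sum>p=r - t + 1..r - 1. 1 / real p) - (real t - 1)"
    using assms by (simp add: sum_subtractf sum_distrib_left of_nat_diff)
  finally have m: "m = real t * (\<Sum>p=1..r - t. 1 / real p) +
    (real r * (\<Sum>p=r - t + 1..r - 1. 1 / real p) - (real t - 1)) - euler_mascheroni * real t" .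
  have "v = (\<Sum>j<t. pi\<^sup>2 / 6 - (\<Sum>p=1..r - j - 1. 1 / (real p)\<^sup>2))"
    unfolding v_def by (intro sum.cong refl) (simp only: pred lessThan_iff Polygamma_one_of_nat)
  also have "\<dots> = pi\<^sup>2 * real t / 6 - real t * (\<Sum>p=1..r - t. 1 / (real p)\<^sup>2) -
      (\<Sum>p=r - t + 1..r - 1. (real r - real p) / (real p)\<^sup>2)"
    using sum_partial_sums[OF assms(2), of "\<lambda>p. 1 / (real p)\<^sup>2"] by (simp add: sum_subtractf)
  finally have v: "v = \<dots>" .
  have "ln a = - ln (pi * exp 1 * \<sigma>2)" using assms by (simp add: a_def ln_div)
  then have "(\<integral>H. \<delta> H \<partial>M) = m - real t * ln (pi * exp 1 * \<sigma>2)"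
    using h\<delta> by (simp add: has_bochner_integral_iff)
  moreover have "M.variance L = v"
    using M.variance_eq[OF intL intL2] by (simp add: EL EL2)
  ultimately show ?thesis
    using h\<delta> intL2 m v by (simp add: has_bochner_integral_iff)
qed

end
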